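(* Let $p$ be a prime, let $\mathbb F$ be a field of characteristic $p$, and let $\lambda=0\in\mathbb F^p$. If $p=2$, then $$H^2_*(\mathfrak m_0^0(2))\cong C^2_*(\mathfrak m_0^0(2))=\operatorname{span}(\{(0,\overline e^1),(0,\overline e^2),(e^{1,2},\tilde e^{1,2})\})$$ is $3$-dimensional. If $p\ge 3$, then $$\dim H^2_*(\mathfrak m_0^0(p))=\frac{3p+1}{2},$$ and the cohomology classes of $$\{(0,\overline e^1),\dots,(0,\overline e^p),(e^{1,p},\tilde e^{1,p}),(\phi_5,\tilde\phi_5),(\phi_7,\tilde\phi_7),\dots,(\phi_{p+2},\tilde\phi_{p+2})\}$$ form a basis, where for odd $k$ with $5\le k\le p+2$, $\phi_k=\sum_{i=2}^{\lfloor k/2\rfloor}(-1)^ie^{i,k-i}$.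
   Context: Let $\mathbb F$ be a field of characteristic $p>0$. $\mathfrak m_0(p)$ is the Lie algebra over $\mathbb F$ with basis $e_1,\dots,e_p$ and brackets $[e_1,e_i]=-[e_i,e_1]=e_{i+1}$ for $1<i<p$, all other brackets of basis elements being $0$. For $\lambda=(\lambda_1,\dots,\lambda_p)\in\mathbb F^p$, $\mathfrak m_0^\lambda(p)$ denotes $\mathfrak m_0(p)$ with the restricted structure $\left(\sum_k\alpha_ke_k\right)^{[p]}=\left(\sum_k\alpha_k^p\lambda_k\right)e_p$. Write $\mathfrak g=\mathfrak m_0^\lambda(p)$. Ordinary cochains (trivial coefficients $\mathbb F$): $C^n(\mathfrak g)=(\wedge^n\mathfrak g)^*$; $\{e^k\}$ is the basis of $\mathfrak g^*$ dual to $\{e_k\}$, and $\{e^{i,j}:1\le i<j\le p\}$ is the basis of $C^2(\mathfrak g)$ dual to $\{e_i\wedge e_j\}$. Differentials: $d^1(\psi)(g,h)=\psi([g,h])$ and $d^2(\phi)(g,h,f)=\phi([g,h]\wedge f)-\phi([g,f]\wedge h)+\phi([h,f]\wedge g)$. Restricted cochains: $C^1_*(\mathfrak g)=\mathfrak g^*$. For $\phi\in C^2(\mathfrak g)$, a map $\omega:\mathfrak g\to\mathbb F$ has the $*$-property with respect to $\phi$ if $\omega(\alpha g)=\alpha^p\omega(g)$ for $\alpha\in\mathbb F$, and for all $g,h\in\mathfrak g$ $$\omega(g+h)=\omega(g)+\omega(h)+\sum\frac{1}{\#(g)}\,\phi([g_1,g_2,\dots,g_{p-1}]\wedge g_p),$$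 the sum being over all formal sequences $(g_1,\dots,g_p)$ with each $g_i$ equal to $g$ or $h$, $g_1=g$, $g_2=h$; $\#(g)$ is the number of positions filled with $g$, and $[g_1,\dots,g_j]=[[\cdots[[g_1,g_2],g_3],\dots],g_j]$ (with $[g_1]=g_1$). Given $\phi$, the values of such $\omega$ on the basis $e_1,\dots,e_p$ can be prescribed arbitrarily and determine $\omega$. $C^2_*(\mathfrak g)$ is the vector space of pairs $(\phi,\omega)$ with $\phi\in C^2(\mathfrak g)$ and $\omega$ having the $*$-property with respect to $\phi$. Put $\overline e^k\left(\sum_i\alpha_ie_i\right)=\alpha_k^p$, and for $\phi\in C^2(\mathfrak g)$ let $\tilde\phi$ be the map with the $*$-property with respect to $\phi$ that vanishes on $e_1,\dots,e_p$; $\tilde e^{i,j}$ is this map for $\phi=e^{i,j}$. Restricted differentials: $d^1_*(\psi)=(d^1\psi,\operatorname{ind}^1(\psi))$ with $\operatorname{ind}^1(\psi)(g)=\psi(g^{[p]})$, and $d^2_*(\phi,\omega)=(d^2\phi,\operatorname{ind}^2(\phi,\omega))$, where $\operatorname{ind}^2(\phi,\omega):\mathfrak g\times\mathfrak g\to\mathbb F$ is $\operatorname{ind}^2(\phi,\omega)(g,h)=\phi(g\wedge h^{[p]})$. Thus $\ker d^2_*$ consists of the pairs with $d^2\phi=0$ and $\operatorname{ind}^2(\phi,\omega)=0$, and $H^2_*(\mathfrak g)=\ker d^2_*/\operatorname{im}d^1_*$. *)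

theory Defs
  imports
    "HOL-Computational_Algebra.Computational_Algebra"
    "HOL-Library.Function_Algebras"
    "HOL-Library.Product_Plus"
begin

text \<open>
  The field \<open>\<bbbF>\<close> is the type \<open>'a\<close>, and the characteristic \<open>p\<close> is \<open>CHAR('a)\<close>.  As \<open>p\<close> is determined by
  the field, the Lie algebra \<open>\<mm>\<^sub>0(p)\<close> over \<open>\<bbbF>\<close> is a type that depends on \<open>'a\<close> only: its elements are
  the coordinate vectors with respect to \<open>e\<^sub>1, \<dots>, e\<^sub>p\<close>, i.e. functions supported on \<open>{1..p}\<close>.
\<close>

typedef (overloaded) 'a m0 = "{x :: nat \<Rightarrow> 'a::field. \<forall>i. i \<notin> {1..CHAR('a)} \<longrightarrow> x i = 0}"
  morphisms coord Abs_m0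
  by (rule exI[of _ "\<lambda>_. 0"]) simp

setup_lifting type_definition_m0

instantiation m0 :: (field) ab_group_add
begin
lift_definition zero_m0 :: "'a m0" is "\<lambda>_. 0" by simp
lift_definition plus_m0 :: "'a m0 \<Rightarrow> 'a m0 \<Rightarrow> 'a m0" is "\<lambda>x y i. x i + y i" by simp
lift_definition minus_m0 :: "'a m0 \<Rightarrow> 'a m0 \<Rightarrow> 'a m0" is "\<lambda>x y i. x i - y i" by simp
lift_definition uminus_m0 :: "'a m0 \<Rightarrow> 'a m0" is "\<lambda>x i. - x i" by simp
instance by standard (transfer; simp add: fun_eq_iff algebra_simps)+
end

lift_definition m0_scale :: "'a::field \<Rightarrow> 'a m0 \<Rightarrow> 'a m0" is "\<lambda>c x i. c * x i" by simp

lift_definition e :: "nat \<Rightarrow> 'a::field m0"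
  is "\<lambda>k i. if i = k \<and> k \<in> {1..CHAR('a)} then 1 else 0" by auto

global_interpretation m0: vector_space "m0_scale :: 'a::field \<Rightarrow> 'a m0 \<Rightarrow> 'a m0"
  by standard (transfer; simp add: fun_eq_iff algebra_simps)+

definition bracket :: "'a::field m0 \<Rightarrow> 'a m0 \<Rightarrow> 'a m0" where
  "bracket x y =
     (\<Sum>i | 1 < i \<and> i < CHAR('a). m0_scale (coord x 1 * coord y i - coord x i * coord y 1) (e (i + 1)))"

definition pmap :: "(nat \<Rightarrow> 'a::field) \<Rightarrow> 'a m0 \<Rightarrow> 'a m0" where
  "pmap lam x = m0_scale (\<Sum>k = 1..CHAR('a). coord x k ^ CHAR('a) * lam k) (e CHAR('a))"

text \<open>\<open>[g\<^sub>1, \<dots>, g\<^sub>j] = [[\<dots>[[g\<^sub>1, g\<^sub>2], g\<^sub>3], \<dots>], g\<^sub>j]\<close>, for a nonempty list.\<close>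

definition left_bracket :: "'a::field m0 list \<Rightarrow> 'a m0" where
  "left_bracket gs = foldl bracket (hd gs) (tl gs)"


text \<open>
  An element \<open>\<phi>\<close> of \<open>C\<^sup>2 = (\<and>\<^sup>2 \<gg>)\<^sup>*\<close> is an alternating bilinear form; \<open>\<phi>(g \<and> h)\<close> is written \<open>\<phi> g h\<close>.
\<close>

definition C1 :: "('a::field m0 \<Rightarrow> 'a) set" where
  "C1 = {\<psi>. Vector_Spaces.linear m0_scale (*) \<psi>}"

definition C2 :: "('a::field m0 \<Rightarrow> 'a m0 \<Rightarrow> 'a) set" where
  "C2 = {\<phi>. (\<forall>h. Vector_Spaces.linear m0_scale (*) (\<lambda>g. \<phi> g h)) \<and>
             (\<forall>g. Vector_Spaces.linear m0_scale (*) (\<phi> g)) \<and>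
             (\<forall>g. \<phi> g g = 0)}"

definition e2 :: "nat \<Rightarrow> nat \<Rightarrow> 'a::field m0 \<Rightarrow> 'a m0 \<Rightarrow> 'a" where
  "e2 i j g h = coord g i * coord h j - coord g j * coord h i"

definition d1 :: "('a::field m0 \<Rightarrow> 'a) \<Rightarrow> 'a m0 \<Rightarrow> 'a m0 \<Rightarrow> 'a" where
  "d1 \<psi> g h = \<psi> (bracket g h)"

definition d2 :: "('a::field m0 \<Rightarrow> 'a m0 \<Rightarrow> 'a) \<Rightarrow> 'a m0 \<Rightarrow> 'a m0 \<Rightarrow> 'a m0 \<Rightarrow> 'a" where
  "d2 \<phi> g h f = \<phi> (bracket g h) f - \<phi> (bracket g f) h + \<phi> (bracket h f) g"


text \<open>
  A formal sequence \<open>(g\<^sub>1, \<dots>, g\<^sub>p)\<close> with entries \<open>g\<close> or \<open>h\<close> is encoded by the list \<open>s\<close> of booleans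
  with \<open>True\<close> at the positions filled with \<open>g\<close>; so \<open>g\<^sub>1 = g\<close> and \<open>g\<^sub>2 = h\<close> become \<open>s ! 0\<close> and \<open>\<not> s ! 1\<close>.
\<close>

definition star_sum :: "('a::field m0 \<Rightarrow> 'a m0 \<Rightarrow> 'a) \<Rightarrow> 'a m0 \<Rightarrow> 'a m0 \<Rightarrow> 'a" where
  "star_sum \<phi> g h =
     (\<Sum>s | length s = CHAR('a) \<and> s ! 0 \<and> \<not> s ! 1.
        let gs = map (\<lambda>b. if b then g else h) s
        in 1 / of_nat (count_list s True) * \<phi> (left_bracket (butlast gs)) (last gs))"

definition star_property :: "('a::field m0 \<Rightarrow> 'a m0 \<Rightarrow> 'a) \<Rightarrow> ('a m0 \<Rightarrow> 'a) \<Rightarrow> bool" where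
  "star_property \<phi> \<omega> \<longleftrightarrow>
     (\<forall>c g. \<omega> (m0_scale c g) = c ^ CHAR('a) * \<omega> g) \<and>
     (\<forall>g h. \<omega> (g + h) = \<omega> g + \<omega> h + star_sum \<phi> g h)"

type_synonym 'a cochain2 = "('a m0 \<Rightarrow> 'a m0 \<Rightarrow> 'a) \<times> ('a m0 \<Rightarrow> 'a)"

definition scale2 :: "'a::field \<Rightarrow> 'a cochain2 \<Rightarrow> 'a cochain2" where
  "scale2 c x = ((\<lambda>g h. c * fst x g h), (\<lambda>g. c * snd x g))"

global_interpretation cochain2: vector_space "scale2 :: 'a::field \<Rightarrow> 'a cochain2 \<Rightarrow> 'a cochain2"
  by standard (simp_all add: scale2_def prod_eq_iff fun_eq_iff algebra_simps)

definition C2_res :: "'a::field cochain2 set" where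
  "C2_res = {(\<phi>, \<omega>). \<phi> \<in> C2 \<and> star_property \<phi> \<omega>}"

definition ebar :: "nat \<Rightarrow> 'a::field m0 \<Rightarrow> 'a" where
  "ebar k g = coord g k ^ CHAR('a)"

definition tilde :: "('a::field m0 \<Rightarrow> 'a m0 \<Rightarrow> 'a) \<Rightarrow> 'a m0 \<Rightarrow> 'a" where
  "tilde \<phi> = (THE \<omega>. star_property \<phi> \<omega> \<and> (\<forall>k \<in> {1..CHAR('a)}. \<omega> (e k) = 0))"

definition ind1 :: "(nat \<Rightarrow> 'a::field) \<Rightarrow> ('a m0 \<Rightarrow> 'a) \<Rightarrow> 'a m0 \<Rightarrow> 'a" where
  "ind1 lam \<psi> g = \<psi> (pmap lam g)"

definition ind2 :: "(nat \<Rightarrow> 'a::field) \<Rightarrow> 'a cochain2 \<Rightarrow> 'a m0 \<Rightarrow> 'a m0 \<Rightarrow> 'a" where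
  "ind2 lam x g h = fst x g (pmap lam h)"

definition d1_res :: "(nat \<Rightarrow> 'a::field) \<Rightarrow> ('a m0 \<Rightarrow> 'a) \<Rightarrow> 'a cochain2" where
  "d1_res lam \<psi> = (d1 \<psi>, ind1 lam \<psi>)"

definition d2_res :: "(nat \<Rightarrow> 'a::field) \<Rightarrow> 'a cochain2 \<Rightarrow>
    ('a m0 \<Rightarrow> 'a m0 \<Rightarrow> 'a m0 \<Rightarrow> 'a) \<times> ('a m0 \<Rightarrow> 'a m0 \<Rightarrow> 'a)" where
  "d2_res lam x = (d2 (fst x), ind2 lam x)"

definition Z2_res :: "(nat \<Rightarrow> 'a::field) \<Rightarrow> 'a cochain2 set" where
  "Z2_res lam = {x \<in> C2_res. d2_res lam x = 0}"

definition B2_res :: "(nat \<Rightarrow> 'a::field) \<Rightarrow> 'a cochain2 set" where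
  "B2_res lam = d1_res lam ` C1"

definition \<phi>_odd :: "nat \<Rightarrow> 'a::field m0 \<Rightarrow> 'a m0 \<Rightarrow> 'a" where
  "\<phi>_odd k g h = (\<Sum>i = 2..k div 2. (-1) ^ i * e2 i (k - i) g h)"


lemma coord_simps [simp]:
  "coord 0 i = 0" "coord (x + y) i = coord x i + coord y i"
  "coord (x - y) i = coord x i - coord y i" "coord (- x) i = - coord x i"
  "coord (m0_scale c x) i = c * coord x i"
  by (transfer; simp)+

lemma coord_sum: "coord (sum f A) i = (\<Sum>a\<in>A. coord (f a) i)"
  by (induction A rule: infinite_finite_induct) auto

lemma coord_e:
  "coord (e k :: 'a::field m0) i = (if i = k \<and> k \<in> {1..CHAR('a)} then 1 else 0)"
  by transfer simp

lemma coord_outside: "i \<notin> {1..CHAR('a)} \<Longrightarrow> coord (x :: 'a::field m0) i = 0"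
  by transfer blast

lemma m0_eqI: "(\<And>i. coord x i = coord y i) \<Longrightarrow> x = y"
  by transfer auto

lemma coord_bracket:
  "coord (bracket x y :: 'a::field m0) j =
     (if 3 \<le> j \<and> j \<le> CHAR('a) then coord x 1 * coord y (j - 1) - coord x (j - 1) * coord y 1 else 0)"
proof -
  have "coord (bracket x y) j = (\<Sum>i | 1 < i \<and> i < CHAR('a).
      if i = j - 1 then (if 1 \<le> j then coord x 1 * coord y (j - 1) - coord x (j - 1) * coord y 1 else 0) else 0)"
    unfolding bracket_def coord_sum
    by (rule sum.cong) (auto simp: coord_e)
  also have "\<dots> = (if 3 \<le> j \<and> j \<le> CHAR('a) then coord x 1 * coord y (j - 1) - coord x (j - 1) * coord y 1 else 0)"
    by (subst sum.delta) auto
  finally show ?thesis .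
qed

lemma bracket_e1:
  assumes "1 < i" "i < CHAR('a::field)"
  shows "bracket (e 1) (e i) = (e (i + 1) :: 'a m0)" and "bracket (e i) (e 1) = - (e (i + 1) :: 'a m0)"
  by (rule m0_eqI; use assms in \<open>auto simp: coord_bracket coord_e\<close>)+

lemma bracket_e_eq_0:
  assumes "i \<noteq> 1 \<or> j = 1 \<or> CHAR('a::field) \<le> j" "j \<noteq> 1 \<or> i = 1 \<or> CHAR('a) \<le> i"
  shows "bracket (e i) (e j) = (0 :: 'a m0)"
  by (rule m0_eqI; use assms in \<open>auto simp: coord_bracket coord_e\<close>)

lemma linear_m0_iff:
  "Vector_Spaces.linear m0_scale (*) (f :: 'a::field m0 \<Rightarrow> 'a) \<longleftrightarrow>
     (\<forall>x y. f (x + y) = f x + f y) \<and> (\<forall>c x. f (m0_scale c x) = c * f x)"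
proof -
  have "vector_space ((*) :: 'a \<Rightarrow> 'a \<Rightarrow> 'a)"
    by standard (simp_all add: algebra_simps)
  thus ?thesis
    unfolding Vector_Spaces.linear_iff using m0.vector_space_axioms by blast
qed

lemma subspace_C2_res: "cochain2.subspace (C2_res :: 'a::field cochain2 set)"
proof -
  have "star_sum (\<phi> + \<phi>') g h = star_sum \<phi> g h + star_sum \<phi>' g h"
    for \<phi> \<phi>' :: "'a m0 \<Rightarrow> 'a m0 \<Rightarrow> 'a" and g h
    by (simp add: star_sum_def Let_def algebra_simps sum.distrib add_divide_distrib)
  moreover have "star_sum (\<lambda>g h. c * \<phi> g h) g h = c * star_sum \<phi> g h"
    for c :: 'a and \<phi> g h
    by (simp add: star_sum_def Let_def sum_distrib_left mult_ac)
  moreover have "star_sum 0 g h = (0 :: 'a)" for g h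
    by (simp add: star_sum_def Let_def)
  ultimately show ?thesis
    unfolding cochain2.subspace_def C2_res_def C2_def linear_m0_iff star_property_def
    by (auto simp: scale2_def zero_prod_def algebra_simps)
qed

lemma subspace_Z2_res: "cochain2.subspace (Z2_res lam)"
proof -
  have "d2_res lam (x + y) = d2_res lam x + d2_res lam y" for x y :: "'a cochain2"
    by (simp add: d2_res_def d2_def ind2_def fun_eq_iff algebra_simps)
  moreover have "d2_res lam 0 = 0"
    by (simp add: d2_res_def d2_def ind2_def fun_eq_iff zero_prod_def)
  moreover have "d2_res lam (scale2 c x) = 0" if "d2_res lam x = 0" for c x
  proof -
    have "d2_res lam (scale2 c x) =
        ((\<lambda>g h f. c * d2 (fst x) g h f), (\<lambda>g h. c * ind2 lam x g h))"
      by (simp add: d2_res_def d2_def ind2_def scale2_def fun_eq_iff algebra_simps)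
    thus ?thesis
      using that by (simp add: d2_res_def zero_prod_def fun_eq_iff)
  qed
  ultimately show ?thesis
    using subspace_C2_res unfolding Z2_res_def cochain2.subspace_def
    by (simp del: split_paired_All split_paired_Ex) blast
qed

lemma subspace_B2_res: "cochain2.subspace (B2_res lam)"
proof (unfold cochain2.subspace_def, intro conjI ballI allI)
  have "0 \<in> C1" "d1_res lam 0 = 0"
    by (simp_all add: C1_def linear_m0_iff d1_res_def d1_def ind1_def fun_eq_iff zero_prod_def)
  thus "0 \<in> B2_res lam"
    unfolding B2_res_def by (metis image_eqI)
next
  fix x y :: "'a cochain2"
  assume "x \<in> B2_res lam" "y \<in> B2_res lam"
  then obtain \<psi> \<psi>' where *: "\<psi> \<in> C1" "\<psi>' \<in> C1" "x = d1_res lam \<psi>" "y = d1_res lam \<psi>'"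
    unfolding B2_res_def by blast
  hence "\<psi> + \<psi>' \<in> C1" "x + y = d1_res lam (\<psi> + \<psi>')"
    by (simp_all add: C1_def linear_m0_iff d1_res_def d1_def ind1_def fun_eq_iff algebra_simps)
  thus "x + y \<in> B2_res lam"
    unfolding B2_res_def by blast
next
  fix c and x :: "'a cochain2"
  assume "x \<in> B2_res lam"
  then obtain \<psi> where *: "\<psi> \<in> C1" "x = d1_res lam \<psi>"
    unfolding B2_res_def by blast
  hence "(\<lambda>g. c * \<psi> g) \<in> C1" "scale2 c x = d1_res lam (\<lambda>g. c * \<psi> g)"
    by (simp_all add: C1_def linear_m0_iff d1_res_def d1_def ind1_def scale2_def fun_eq_iff algebra_simps)
  thus "scale2 c x \<in> B2_res lam"
    unfolding B2_res_def by blast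
qed

lemma coord_left_bracket:
  assumes "2 \<le> length gs" "j \<le> length gs"
  shows "coord (left_bracket gs) j = 0"
  using assms
proof (induction gs arbitrary: j rule: rev_induct)
  case (snoc x gs)
  show ?case
  proof (cases "length gs = 1")
    case True
    then obtain y where "gs = [y]"
      by (auto simp: length_Suc_conv)
    thus ?thesis
      using snoc.prems by (simp add: left_bracket_def coord_bracket)
  next
    case False
    hence "2 \<le> length gs"
      using snoc.prems by auto
    hence "coord (left_bracket gs) 1 = 0" "j - 1 \<le> length gs \<Longrightarrow> coord (left_bracket gs) (j - 1) = 0"
      using snoc.IH by auto
    moreover have "left_bracket (gs @ [x]) = bracket (left_bracket gs) x"
      using \<open>2 \<le> length gs\<close> by (cases gs) (auto simp: left_bracket_def)
    ultimately show ?thesis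
      using snoc.prems by (simp add: coord_bracket)
  qed
qed simp

lemma B2_res_subset_Z2_res:
  assumes "CHAR('a::field) > 0"
  shows "B2_res (\<lambda>_. 0) \<subseteq> (Z2_res (\<lambda>_. 0) :: 'a cochain2 set)"
proof
  fix x :: "'a cochain2"
  assume "x \<in> B2_res (\<lambda>_. 0)"
  then obtain \<psi> where \<psi>: "\<psi> \<in> C1" and x: "x = d1_res (\<lambda>_. 0) \<psi>"
    unfolding B2_res_def by blast
  have p: "CHAR('a) \<ge> 2"
    using assms CHAR_not_1' by (metis One_nat_def Suc_1 Suc_leI le_neq_implies_less)
  have add: "\<psi> (g + h) = \<psi> g + \<psi> h" and scale: "\<psi> (m0_scale c g) = c * \<psi> g" for c g h
    using \<psi> by (auto simp: C1_def linear_m0_iff)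
  have zero: "\<psi> 0 = 0"
    using scale[of 0 0] by simp
  have diff: "\<psi> (g - h) = \<psi> g - \<psi> h" for g h
    using add[of "g - h" h] by (simp add: algebra_simps)
  have "star_sum (d1 \<psi>) g h = 0" for g h
    unfolding star_sum_def
  proof (rule sum.neutral, safe)
    fix s :: "bool list"
    assume s: "length s = CHAR('a)"
    define gs where "gs = map (\<lambda>b. if b then g else h) s"
    have len: "length gs = CHAR('a)"
      using s by (simp add: gs_def)
    obtain ys y where gs: "gs = ys @ [y]" "ys \<noteq> []"
      using p len by (cases gs rule: rev_cases) fastforce+
    have "bracket (left_bracket (butlast gs)) (last gs) = left_bracket gs"
      using gs by (cases ys) (auto simp: left_bracket_def)
    also have "left_bracket gs = 0"
    proof (rule m0_eqI)
      fix i show "coord (left_bracket gs) i = coord 0 i"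
        using coord_left_bracket[of gs i] coord_outside[of i "left_bracket gs"] p len
        by (cases "i \<le> CHAR('a)") auto
    qed
    finally show "(let gs = map (\<lambda>b. if b then g else h) s
        in 1 / of_nat (count_list s True) * d1 \<psi> (left_bracket (butlast gs)) (last gs)) = 0"
      unfolding gs_def[symmetric] by (simp add: Let_def d1_def zero)
  qed
  moreover have "pmap (\<lambda>_. 0) g = (0 :: 'a m0)" for g
    by (rule m0_eqI) (simp add: pmap_def)
  moreover have "bracket g g = 0" "bracket (g + g') h = bracket g h + bracket g' h"
    "bracket g (h + h') = bracket g h + bracket g h'"
    "bracket (m0_scale c g) h = m0_scale c (bracket g h)"
    "bracket g (m0_scale c h) = m0_scale c (bracket g h)" for g g' h h' :: "'a m0" and c
    by (rule m0_eqI; simp add: coord_bracket algebra_simps)+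
  moreover have "d2 (d1 \<psi>) g h f = 0" for g h f
  proof -
    have "bracket (bracket g h) f - bracket (bracket g f) h + bracket (bracket h f) g = 0"
      by (rule m0_eqI) (auto simp: coord_bracket algebra_simps)
    thus ?thesis
      by (simp add: d2_def d1_def zero flip: add diff)
  qed
  moreover have "bracket g 0 = 0" for g :: "'a m0"
    by (rule m0_eqI) (simp add: coord_bracket)
  ultimately show "x \<in> Z2_res (\<lambda>_. 0)"
    using assms unfolding x
    by (simp add: Z2_res_def C2_res_def C2_def star_property_def d1_res_def d2_res_def
        ind1_def ind2_def d1_def linear_m0_iff add scale zero zero_prod_def fun_eq_iff)
qed


text \<open>
  The quotient \<open>H\<^sup>2\<^sub>*(\<mm>\<^sub>0\<^sup>0(p)) = ker d\<^sup>2\<^sub>* / im d\<^sup>1\<^sub>*\<close>.  A type cannot depend on the parameter of the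
  restricted structure, so \<open>\<lambda> = 0\<close> is fixed here.  The abstraction function \<open>cohom_class\<close> sends a
  cocycle to its class (and is meaningless outside \<open>Z2_res (\<lambda>_. 0)\<close>).
\<close>

definition cohomologous :: "'a::field cochain2 \<Rightarrow> 'a cochain2 \<Rightarrow> bool" where
  "cohomologous x y \<longleftrightarrow>
     x \<in> Z2_res (\<lambda>_. 0) \<and> y \<in> Z2_res (\<lambda>_. 0) \<and> x - y \<in> B2_res (\<lambda>_. 0)"

quotient_type (overloaded) 'a H2_res = "'a::field cochain2" / partial: cohomologous
  morphisms Rep_H2_res cohom_class
proof (rule part_equivpI)
  show "\<exists>x :: 'a cochain2. cohomologous x x"
    using cochain2.subspace_0[OF subspace_Z2_res] cochain2.subspace_0[OF subspace_B2_res]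
    unfolding cohomologous_def by (metis diff_self)
  show "symp (cohomologous :: 'a cochain2 \<Rightarrow> _)"
    using cochain2.subspace_neg[OF subspace_B2_res]
    by (force simp: cohomologous_def symp_def)
  show "transp (cohomologous :: 'a cochain2 \<Rightarrow> _)"
    using cochain2.subspace_add[OF subspace_B2_res]
    by (force simp: cohomologous_def transp_def)
qed

lemma cohomologous_refl: "x \<in> Z2_res (\<lambda>_. 0) \<Longrightarrow> cohomologous x x"
  using cochain2.subspace_0[OF subspace_B2_res] by (auto simp: cohomologous_def)

instantiation H2_res :: (field) ab_group_add
begin

lift_definition zero_H2_res :: "'a H2_res" is 0
  by (intro cohomologous_refl cochain2.subspace_0 subspace_Z2_res)

lift_definition plus_H2_res :: "'a H2_res \<Rightarrow> 'a H2_res \<Rightarrow> 'a H2_res" is "(+)"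
  unfolding cohomologous_def add_diff_add
  by (blast intro: cochain2.subspace_add subspace_Z2_res subspace_B2_res)

lift_definition uminus_H2_res :: "'a H2_res \<Rightarrow> 'a H2_res" is uminus
  unfolding cohomologous_def minus_diff_minus
  by (blast intro: cochain2.subspace_neg subspace_Z2_res subspace_B2_res)

definition minus_H2_res :: "'a H2_res \<Rightarrow> 'a H2_res \<Rightarrow> 'a H2_res" where
  "minus_H2_res x y = x + - y"

instance
proof
  fix a b c :: "'a H2_res"
  show "a + b + c = a + (b + c)"
    by transfer (auto simp: add.assoc intro!: cohomologous_refl cochain2.subspace_add
        subspace_Z2_res simp: cohomologous_def)
  show "a + b = b + a"
    by transfer (auto simp: add.commute cohomologous_def cochain2.subspace_add
        cochain2.subspace_0 subspace_Z2_res subspace_B2_res)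
  show "0 + a = a"
    by transfer (simp add: cohomologous_def)
  show "- a + a = 0"
    by transfer (simp add: cohomologous_def cochain2.subspace_0 subspace_Z2_res subspace_B2_res)
  show "a - b = a + - b"
    by (rule minus_H2_res_def)
qed

end

lift_definition scale_H2 :: "'a::field \<Rightarrow> 'a H2_res \<Rightarrow> 'a H2_res" is scale2
  unfolding cohomologous_def cochain2.scale_right_diff_distrib[symmetric]
  by (blast intro: cochain2.subspace_scale subspace_Z2_res subspace_B2_res)

global_interpretation H2: vector_space "scale_H2 :: 'a::field \<Rightarrow> 'a H2_res \<Rightarrow> 'a H2_res"
proof
  fix a b :: 'a and x y :: "'a H2_res"
  show "scale_H2 a (x + y) = scale_H2 a x + scale_H2 a y"
    by transfer (auto simp: cochain2.scale_right_distrib cohomologous_def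
        intro!: cohomologous_refl cochain2.subspace_add cochain2.subspace_scale subspace_Z2_res)
  show "scale_H2 (a + b) x = scale_H2 a x + scale_H2 b x"
    by transfer (auto simp: cochain2.scale_left_distrib cohomologous_def
        intro!: cohomologous_refl cochain2.subspace_add cochain2.subspace_scale subspace_Z2_res)
  show "scale_H2 a (scale_H2 b x) = scale_H2 (a * b) x"
    by transfer (auto simp: cohomologous_def
        intro!: cohomologous_refl cochain2.subspace_scale subspace_Z2_res)
  show "scale_H2 1 x = x"
    by transfer simp
qed

lemma cohom_class_eq_iff:
  assumes "x \<in> Z2_res (\<lambda>_. 0)" "y \<in> Z2_res (\<lambda>_. 0)"
  shows "cohom_class x = cohom_class y \<longleftrightarrow> x - y \<in> B2_res (\<lambda>_. 0)"
  using Quotient_rel[OF Quotient_H2_res, of x y] cohomologous_refl[OF assms(1)]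
    cohomologous_refl[OF assms(2)] assms
  by (simp add: cohomologous_def)

end

theory Submission
  imports Defs
begin

text \<open>
  Since \<open>\<lambda> = 0\<close>, the condition on \<open>ind\<^sup>2\<close> is void, so a cocycle is a pair \<open>(\<phi>, \<omega>)\<close> with \<open>d\<^sup>2\<phi> = 0\<close>.
  The only nonzero \<open>(p - 1)\<close>-fold brackets are multiples of \<open>e\<^sub>p\<close>, so the correction term of the
  \<open>*\<close>-property depends on \<open>\<phi>(e\<^sub>p, _)\<close> only; with the binomial coefficients reduced modulo \<open>p\<close> it can be
  summed in closed form, which gives (for \<open>g\<close> with coordinates \<open>g\<^sub>i\<close>) \<open>g\<^sub>1\<^bsup>p-1\<^esup> g\<^sub>2\<close> as the map \<open>\<omega>\<close> of
  \<open>e\<^sup>1\<^sup>,\<^sup>p\<close>, \<open>g\<^sub>1\<^bsup>p-2\<^esup> g\<^sub>2\<^sup>2 / 2\<close> as that of \<open>\<phi>\<^sub>p\<^sub>+\<^sub>2\<close>, and \<open>0\<close> for the smaller \<open>\<phi>\<^sub>k\<close>.  The functionals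
  \<open>\<omega>(e\<^sub>k)\<close>, \<open>\<phi>(e\<^sub>1, e\<^sub>p)\<close> and \<open>\<phi>(e\<^sub>2, e\<^sub>k\<^sub>-\<^sub>2)\<close> kill the coboundaries and are dual to the claimed basis.
  A cocycle on which all of them vanish is a coboundary: the cocycle identity determines \<open>\<phi>\<close> on each
  antidiagonal \<open>i + j = k\<close> with \<open>i, j \<ge> 2\<close> by its value at \<open>(e\<^sub>2, e\<^sub>k\<^sub>-\<^sub>2)\<close>, and the remaining values
  \<open>\<phi>(e\<^sub>1, e\<^sub>j)\<close> with \<open>j < p\<close> are those of \<open>d\<^sup>1\<psi>\<close> for \<open>\<psi>(e\<^sub>j\<^sub>+\<^sub>1) = \<phi>(e\<^sub>1, e\<^sub>j)\<close>.
\<close>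

section \<open>Binomial coefficients in characteristic \<open>p\<close>\<close>

lemma of_nat_CHAR_minus:
  assumes "k \<le> CHAR('a::field)"
  shows "(of_nat (CHAR('a) - k) :: 'a) = - of_nat k"
  using assms by (simp add: of_nat_diff)

lemma of_nat_nonzero_below_CHAR:
  assumes "0 < k" "k < CHAR('a::field)"
  shows "(of_nat k :: 'a) \<noteq> 0"
  using assms by (auto simp: of_nat_eq_0_iff_char_dvd dest: dvd_imp_le)

text \<open>By Pascal's rule two neighbours in row p - 1 add up to an entry of row p that p divides,
  so each entry is minus the previous one.\<close>

lemma of_nat_CHAR_minus_1_choose:
  assumes "prime CHAR('a::field)" "k < CHAR('a)"
  shows "(of_nat ((CHAR('a) - 1) choose k) :: 'a) = (-1) ^ k"
  using assms(2)
proof (induction k)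
  case (Suc k)
  obtain n where n: "CHAR('a) = Suc n"
    using Suc.prems that[of "CHAR('a) - 1"] by simp
  have "CHAR('a) dvd (CHAR('a) choose Suc k)"
    using assms(1) Suc.prems by (intro dvd_choose_prime) auto
  hence "(of_nat (Suc n choose Suc k) :: 'a) = 0"
    unfolding n[symmetric] of_nat_eq_0_iff_char_dvd .
  hence "(of_nat (n choose Suc k) :: 'a) = - of_nat (n choose k)"
    by (simp add: eq_neg_iff_add_eq_0 add.commute)
  thus ?case
    using Suc n by simp
qed simp

text \<open>Neighbours in row p - 2 add up to the known sign in row p - 1, so each step flips the
  sign and raises the factor by one.\<close>

lemma of_nat_CHAR_minus_2_choose:
  assumes "prime CHAR('a::field)" "k \<le> CHAR('a) - 2"
  shows "(of_nat ((CHAR('a) - 2) choose k) :: 'a) = (-1) ^ k * of_nat (k + 1)"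
  using assms(2)
proof (induction k)
  case (Suc k)
  obtain n where n: "CHAR('a) = Suc (Suc n)"
    using Suc.prems that[of "CHAR('a) - 2"] by simp
  have "(of_nat (Suc n choose Suc k) :: 'a) = (-1) ^ Suc k"
    using of_nat_CHAR_minus_1_choose[OF assms(1), of "Suc k"] Suc.prems n by simp
  hence "(of_nat (n choose Suc k) :: 'a) = (-1) ^ Suc k - of_nat (n choose k)"
    by (simp add: eq_diff_eq add.commute)
  also have "of_nat (n choose k) = ((-1) ^ k * of_nat (k + 1) :: 'a)"
    using Suc n by simp
  finally show ?case
    using n by (simp add: algebra_simps)
qed simp

text \<open>Row p - 3 will count the entries g among the p - 3 free positions of a formal sequence,
  with #(g) equal to k + 1 or k + 2. Absorption leads to row p - 2, and p - 2 is -2 in the field;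
  one factor of (k + 1)(k + 2)/2 then cancels against the denominator.\<close>

lemma of_nat_CHAR_minus_3_choose:
  assumes "prime CHAR('a::field)" "3 \<le> CHAR('a)" "k \<le> CHAR('a) - 3"
  shows "(of_nat ((CHAR('a) - 3) choose k) / of_nat (k + 1) :: 'a) = (-1) ^ k * of_nat (k + 2) / 2"
    and "(of_nat ((CHAR('a) - 3) choose k) / of_nat (k + 2) :: 'a) = (-1) ^ k * of_nat (k + 1) / 2"
proof -
  obtain n where n: "CHAR('a) = Suc (Suc (Suc n))"
    using assms(2) that[of "CHAR('a) - 3"] by simp
  have ne: "(2 :: 'a) \<noteq> 0" "(of_nat (k + 1) :: 'a) \<noteq> 0" "(of_nat (k + 2) :: 'a) \<noteq> 0"
    using of_nat_nonzero_below_CHAR[where 'a='a, of 2] of_nat_nonzero_below_CHAR[where 'a='a, of "k + 1"]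
      of_nat_nonzero_below_CHAR[where 'a='a, of "k + 2"] assms by auto
  have "(of_nat (Suc k * (Suc n choose Suc k)) :: 'a) = of_nat (Suc n * (n choose k))"
    by (simp only: Suc_times_binomial)
  moreover have "(of_nat (Suc n choose Suc k) :: 'a) = (-1) ^ Suc k * of_nat (k + 2)"
    using of_nat_CHAR_minus_2_choose[OF assms(1), of "Suc k"] assms n by (simp add: algebra_simps)
  moreover have "(of_nat (Suc n) :: 'a) = - 2"
    using of_nat_CHAR_minus[of 2, where 'a='a] n by simp
  ultimately have "of_nat (k + 1) * ((-1) ^ Suc k * of_nat (k + 2)) = (- 2 :: 'a) * of_nat (n choose k)"
    by (simp only: of_nat_mult Suc_eq_plus1)
  hence "2 * of_nat (n choose k) = ((-1) ^ k * of_nat (k + 1) * of_nat (k + 2) :: 'a)"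
    by (simp add: algebra_simps)
  hence "(of_nat (n choose k) :: 'a) = (-1) ^ k * of_nat (k + 1) * of_nat (k + 2) / 2"
    using ne by (simp add: eq_divide_eq mult.commute)
  moreover have "c / x = s * y / 2 \<and> c / y = s * x / 2"
    if "c = s * x * y / 2" "x \<noteq> 0" "y \<noteq> 0" for c s x y :: 'a
    using that by simp
  moreover have "CHAR('a) - 3 = n"
    using n by simp
  ultimately show "(of_nat ((CHAR('a) - 3) choose k) / of_nat (k + 1) :: 'a) = (-1) ^ k * of_nat (k + 2) / 2"
    and "(of_nat ((CHAR('a) - 3) choose k) / of_nat (k + 2) :: 'a) = (-1) ^ k * of_nat (k + 1) / 2"
    using ne(2,3) by metis+
qed

lemma CHAR_prime_ge_3_facts:
  assumes "prime CHAR('a::field)" "3 \<le> CHAR('a)"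
  shows "odd CHAR('a)" and "(2 :: 'a) \<noteq> 0"
  using assms prime_odd_nat of_nat_nonzero_below_CHAR[where 'a='a, of 2] by force+

text \<open>Splitting off the first entry shifts \<open>f\<close> by one in the \<open>True\<close>
  branch, hence the induction over arbitrary \<open>f\<close>; Pascal's rule merges the
  branches.\<close>

lemma sum_lists_length_by_count:
  fixes f :: "nat \<Rightarrow> 'b::comm_semiring_1"
  shows "(\<Sum>s | length s = n. f (count_list s True)) = (\<Sum>k\<le>n. of_nat (n choose k) * f k)"
proof (induction n arbitrary: f)
  case (Suc n)
  have eq: "{s :: bool list. length s = Suc n} = Cons True ` {s. length s = n} \<union> Cons False ` {s. length s = n}"
    by (auto simp: length_Suc_conv image_iff)
  have fin: "finite {s :: bool list. length s = n}"
    using finite_lists_length_eq[of "UNIV :: bool set" n] by simp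
  have "(\<Sum>s | length s = Suc n. f (count_list s True)) =
      (\<Sum>s | length s = n. f (Suc (count_list s True))) + (\<Sum>s | length s = n. f (count_list s True))"
    unfolding eq by (subst sum.union_disjoint) (use fin in \<open>auto simp: sum.reindex inj_on_def\<close>)
  also have "\<dots> = (\<Sum>k\<le>n. of_nat (n choose k) * f (Suc k)) + (\<Sum>k\<le>n. of_nat (n choose k) * f k)"
    by (simp add: Suc.IH[of "\<lambda>k. f (Suc k)"] Suc.IH[of f])
  \<comment> \<open>The added term is 0; it lets both sums run up to n once the index is
    shifted.\<close>
  also have "(\<Sum>k\<le>n. of_nat (n choose k) * f k) = (\<Sum>k\<le>Suc n. of_nat (n choose k) * f k)"
    by (simp add: binomial_eq_0)
  also have "\<dots> = f 0 + (\<Sum>k\<le>n. of_nat (n choose Suc k) * f (Suc k))"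
    by (subst sum.atMost_Suc_shift) simp
  also have "(\<Sum>k\<le>n. of_nat (n choose k) * f (Suc k)) + (f 0 + (\<Sum>k\<le>n. of_nat (n choose Suc k) * f (Suc k)))
      = f 0 + (\<Sum>k\<le>n. of_nat (Suc n choose Suc k) * f (Suc k))"
    by (simp add: sum.distrib algebra_simps)
  also have "\<dots> = (\<Sum>k\<le>Suc n. of_nat (Suc n choose k) * f k)"
    by (subst sum.atMost_Suc_shift) simp
  finally show ?case .
qed simp

section \<open>The sum in the \<open>*\<close>-property\<close>

lemma left_bracket_snoc: "ys \<noteq> [] \<Longrightarrow> left_bracket (ys @ [y]) = bracket (left_bracket ys) y"
  by (cases ys) (auto simp: left_bracket_def)

text \<open>An iterated bracket has no e_1-component, so bracketing with y on the right shifts its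
  coordinates up by one and multiplies them by -y_1. The index \<open>length ys + 3\<close> is the
  lowest one that can survive.\<close>

lemma coord_left_bracket_Cons_Cons:
  assumes "length ys + 3 \<le> CHAR('a::field)"
  shows "coord (left_bracket (g # h # ys) :: 'a m0) (length ys + 3) =
    (coord g 1 * coord h 2 - coord g 2 * coord h 1) * (\<Prod>y\<leftarrow>ys. - coord y 1)"
  using assms
proof (induction ys rule: rev_induct)
  case Nil
  thus ?case by (simp add: left_bracket_def coord_bracket)
next
  case (snoc y ys)
  have "coord (left_bracket (g # h # ys)) 1 = 0"
    by (rule coord_left_bracket) auto
  moreover have "left_bracket (g # h # ys @ [y]) = bracket (left_bracket (g # h # ys)) y"
    using left_bracket_snoc[of "g # h # ys" y] by simp
  ultimately show ?case
    using snoc by (simp add: coord_bracket add.commute[of 3])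
qed

text \<open>With p - 1 entries all coordinates below p vanish, so only the lowest surviving one is
  left, now at index p.\<close>

lemma left_bracket_eq_scale_top:
  assumes "length ys + 3 = CHAR('a::field)"
  shows "left_bracket (g # h # ys) = m0_scale
    ((coord g 1 * coord h 2 - coord g 2 * coord h 1) * (\<Prod>y\<leftarrow>ys. - coord y 1)) (e CHAR('a) :: 'a m0)"
proof (rule m0_eqI)
  fix j
  consider "j \<le> length ys + 2" | "j = length ys + 3" | "j \<notin> {1..CHAR('a)}"
    using assms by force
  thus "coord (left_bracket (g # h # ys)) j = coord (m0_scale
    ((coord g 1 * coord h 2 - coord g 2 * coord h 1) * (\<Prod>y\<leftarrow>ys. - coord y 1)) (e CHAR('a) :: 'a m0)) j"
  proof cases
    case 1
    thus ?thesis
      using coord_left_bracket[of "g # h # ys" j] assms by (simp add: coord_e)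
  next
    case 2
    thus ?thesis
      using coord_left_bracket_Cons_Cons[of ys g h] assms by (simp add: coord_e)
  next
    case 3
    thus ?thesis by (simp add: coord_outside)
  qed
qed

lemma prod_list_if_eq_power:
  fixes x y :: "'b::comm_monoid_mult"
  shows "(\<Prod>b\<leftarrow>s. if b then x else y) = x ^ count_list s True * y ^ (length s - count_list s True)"
proof (induction s)
  case (Cons b s)
  have "count_list s True \<le> length s"
    by (rule count_le_length)
  thus ?case
    using Cons by (simp add: Suc_diff_le mult_ac)
qed simp

lemma C2_simps:
  assumes "\<phi> \<in> C2"
  shows "\<phi> (g + g') h = \<phi> g h + \<phi> g' h" "\<phi> g (h + h') = \<phi> g h + \<phi> g h'"
    "\<phi> (m0_scale c g) h = c * \<phi> g h" "\<phi> g (m0_scale c h) = c * \<phi> g h"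
    "\<phi> g g = 0" "\<phi> 0 h = 0" "\<phi> g 0 = 0" "\<phi> g h = - \<phi> h g"
proof -
  show *: "\<phi> (g + g') h = \<phi> g h + \<phi> g' h" "\<phi> g (h + h') = \<phi> g h + \<phi> g h'"
    "\<phi> (m0_scale c g) h = c * \<phi> g h" "\<phi> g (m0_scale c h) = c * \<phi> g h"
    "\<phi> g g = 0" for g g' h h' c
    using assms by (auto simp: C2_def linear_m0_iff)
  show "\<phi> 0 h = 0" "\<phi> g 0 = 0"
    using *(3)[of 0 0 h] *(4)[of g 0 0] by simp_all
  have "\<phi> (g + h) (g + h) = 0"
    by (rule *(5))
  thus "\<phi> g h = - \<phi> h g"
    unfolding *(1,2) by (simp add: *(5) eq_neg_iff_add_eq_0 add.commute)
qed

text \<open>The first two entries are fixed and the last one enters \<phi> separately, so the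
  sequences are grouped by the number a of entries g among the n = p - 3 in between; #(g) is a + 1
  or a + 2 according to the last entry. The binomials divided by #(g) then become linear in a up to
  sign.\<close>

lemma star_sum_eq:
  fixes \<phi> :: "'a::field m0 \<Rightarrow> 'a m0 \<Rightarrow> 'a"
  assumes "prime CHAR('a)" "3 \<le> CHAR('a)" "\<phi> \<in> C2"
  defines "n \<equiv> CHAR('a) - 3"
  shows "star_sum \<phi> g h = (coord g 1 * coord h 2 - coord g 2 * coord h 1) / 2 *
    ((\<Sum>a\<le>n. (-1) ^ a * of_nat (a + 1) * coord g 1 ^ a * coord h 1 ^ (n - a)) * \<phi> (e CHAR('a)) g +
     (\<Sum>a\<le>n. (-1) ^ a * of_nat (a + 2) * coord g 1 ^ a * coord h 1 ^ (n - a)) * \<phi> (e CHAR('a)) h)"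
proof -
  define D where "D = coord g 1 * coord h 2 - coord g 2 * coord h 1"
  define pick where "pick = (\<lambda>b. if b then g else h)"
  define P where "P = (\<lambda>a. coord g 1 ^ a * coord h 1 ^ (n - a))"
  define G where "G = (\<lambda>s. 1 / of_nat (count_list s True) *
      \<phi> (left_bracket (butlast (map pick s))) (last (map pick s)))"
  have n: "CHAR('a) = n + 3" "even n"
    using assms CHAR_prime_ge_3_facts(1)[where 'a='a] by (auto simp: n_def)
  have set: "{s. length s = CHAR('a) \<and> s ! 0 \<and> \<not> s ! 1} =
      (\<lambda>t. True # False # t @ [True]) ` {t. length t = n} \<union>
      (\<lambda>t. True # False # t @ [False]) ` {t. length t = n}" (is "?A = ?B")
  proof
    show "?A \<subseteq> ?B"
    proof
      fix s assume s: "s \<in> ?A"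
      then obtain u where u: "s = True # False # u" "length u = Suc n"
        using n by (auto simp: eval_nat_numeral length_Suc_conv)
      then obtain t b where "u = t @ [b]" "length t = n"
        by (metis length_append_singleton length_Suc_conv_rev nat.inject)
      thus "s \<in> ?B"
        using u by (cases b) auto
    qed
    show "?B \<subseteq> ?A"
      using n by auto
  qed
  have fin: "finite {s :: bool list. length s = n}"
    using finite_lists_length_eq[of "UNIV :: bool set" n] by simp
  have G: "G (True # False # t @ [b]) =
      D * \<phi> (e CHAR('a)) (pick b) * (P (count_list t True) / of_nat (count_list t True + 1 + (if b then 1 else 0)))"
    if "length t = n" for t b
  proof -
    have "(\<Prod>y\<leftarrow>map pick t. - coord y 1) = (\<Prod>b\<leftarrow>t. if b then - coord g 1 else - coord h 1)"
      unfolding map_map o_def pick_def by (intro arg_cong[where f = prod_list] map_cong) auto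
    also have "\<dots> = (- coord g 1) ^ count_list t True * (- coord h 1) ^ (n - count_list t True)"
      unfolding prod_list_if_eq_power that ..
    also have "\<dots> = (-1) ^ (count_list t True + (n - count_list t True)) * P (count_list t True)"
      unfolding P_def by (simp only: power_minus[of "coord g 1"] power_minus[of "coord h 1"] power_add mult_ac)
    also have "count_list t True + (n - count_list t True) = n"
      using count_le_length[of t True] that by simp
    \<comment> \<open>As p is odd, n is even and the sign (-1)^n drops out.\<close>
    finally have "(\<Prod>y\<leftarrow>map pick t. - coord y 1) = P (count_list t True)"
      using n by simp
    hence "left_bracket (g # h # map pick t) = m0_scale (D * P (count_list t True)) (e CHAR('a))"
      using left_bracket_eq_scale_top[of "map pick t" g h] n that by (simp add: D_def)
    moreover have "map pick (True # False # t @ [b]) = (g # h # map pick t) @ [pick b]"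
      by (simp add: pick_def)
    ultimately show ?thesis
      unfolding G_def by (simp only: butlast_snoc last_snoc C2_simps(3)[OF assms(3)]) (simp add: mult_ac)
  qed
  have sumG: "(\<Sum>t | length t = n. G (True # False # t @ [b])) =
      D * \<phi> (e CHAR('a)) (pick b) * (\<Sum>a\<le>n. of_nat (n choose a) / of_nat (a + 1 + (if b then 1 else 0)) * P a)" for b
  proof -
    have "(\<Sum>t | length t = n. G (True # False # t @ [b])) = D * \<phi> (e CHAR('a)) (pick b) *
        (\<Sum>t | length t = n. P (count_list t True) / of_nat (count_list t True + 1 + (if b then 1 else 0)))"
      unfolding sum_distrib_left by (rule sum.cong) (simp_all only: G mem_Collect_eq)
    also have "(\<Sum>t | length t = n. P (count_list t True) / of_nat (count_list t True + 1 + (if b then 1 else 0)))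
        = (\<Sum>a\<le>n. of_nat (n choose a) * (P a / of_nat (a + 1 + (if b then 1 else 0))))"
      by (rule sum_lists_length_by_count)
    finally show ?thesis
      by (simp add: mult_ac)
  qed
  have "star_sum \<phi> g h = sum G {s. length s = CHAR('a) \<and> s ! 0 \<and> \<not> s ! 1}"
    by (simp add: star_sum_def G_def pick_def Let_def)
  also have "\<dots> = (\<Sum>t | length t = n. G (True # False # t @ [True])) +
      (\<Sum>t | length t = n. G (True # False # t @ [False]))"
    unfolding set by (subst sum.union_disjoint) (use fin in \<open>auto simp: sum.reindex inj_on_def\<close>)
  also have "(\<Sum>t | length t = n. G (True # False # t @ [True])) =
      D * \<phi> (e CHAR('a)) g * (\<Sum>a\<le>n. (-1) ^ a * of_nat (a + 1) / 2 * P a)"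
    unfolding sumG using of_nat_CHAR_minus_3_choose(2)[OF assms(1,2), folded n_def]
    by (intro arg_cong2[where f = "(*)"] sum.cong) (simp_all only: atMost_iff pick_def if_True add.assoc one_add_one)
  also have "(\<Sum>t | length t = n. G (True # False # t @ [False])) =
      D * \<phi> (e CHAR('a)) h * (\<Sum>a\<le>n. (-1) ^ a * of_nat (a + 2) / 2 * P a)"
    unfolding sumG using of_nat_CHAR_minus_3_choose(1)[OF assms(1,2), folded n_def]
    by (intro arg_cong2[where f = "(*)"] sum.cong) (simp_all only: atMost_iff pick_def if_False add_0_right)
  finally show ?thesis
    unfolding D_def[symmetric] P_def
    by (simp only: sum_distrib_left sum_distrib_right distrib_left times_divide_eq_left times_divide_eq_right mult_ac)
qed

text \<open>These are the sums of \<open>star_sum_eq\<close>. The products \<open>y * S 1\<close>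
  and \<open>x * S 2\<close> are truncated binomial expansions of exponent p - 2, and
  \<open>S 2 - S 1\<close> is a geometric sum; the last three identities combine these with
  polynomial coefficients. Everything stays multiplied out because x or y may be 0.\<close>

lemma alternating_power_sums:
  fixes x y :: "'a::field"
  assumes "prime CHAR('a)" "3 \<le> CHAR('a)"
  defines "n \<equiv> CHAR('a) - 3"
  defines "S \<equiv> \<lambda>c. \<Sum>a\<le>n. (-1) ^ a * of_nat (a + c) * x ^ a * y ^ (n - a)"
  shows "y * S 1 = (x + y) ^ (n + 1) - x ^ (n + 1)"
    and "x * S 2 = y ^ (n + 1) - (x + y) ^ (n + 1)"
    and "y * S 2 - x * S 1 = 2 * (x + y) ^ (n + 1)"
    and "y * (x * S 1 + y * S 2) = 2 * ((x + y) ^ (n + 2) - x ^ (n + 2))"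
    and "x * (x * S 1 + y * S 2) = 2 * (y ^ (n + 2) - (x + y) ^ (n + 2))"
proof -
  have n: "CHAR('a) = n + 3" "even n"
    using assms CHAR_prime_ge_3_facts(1)[where 'a='a] by (auto simp: n_def)
  hence n2: "CHAR('a) - 2 = Suc n"
    by simp
  define f where "f = (\<lambda>k. (-1) ^ k * of_nat (k + 1) * x ^ k * y ^ (Suc n - k))"
  have "(x + y) ^ Suc n = (\<Sum>k\<le>Suc n. of_nat (Suc n choose k) * x ^ k * y ^ (Suc n - k))"
    by (rule binomial_ring)
  also have "\<dots> = sum f {..Suc n}"
    unfolding f_def using of_nat_CHAR_minus_2_choose[OF assms(1)] n2
    by (intro sum.cong refl) (simp only: atMost_iff)
  finally have f: "(x + y) ^ Suc n = sum f {..Suc n}" .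
  \<comment> \<open>\<open>Suc n + 1\<close> is p - 1, so the coefficient of x^(n+1) is (-1)^(n+1)
    (p - 1) = 1.\<close>
  have top: "(of_nat (Suc n + 1) :: 'a) = - 1"
    using of_nat_CHAR_minus[of 1, where 'a='a] n by simp
  have "y * S 1 = sum f {..n}"
    unfolding S_def f_def sum_distrib_left
    by (intro sum.cong refl) (simp add: Suc_diff_le algebra_simps)
  moreover have "f (Suc n) = x ^ Suc n"
    using n(2) unfolding f_def top by simp
  ultimately show A: "y * S 1 = (x + y) ^ (n + 1) - x ^ (n + 1)"
    using f by (simp add: eq_diff_eq)
  \<comment> \<open>Shifting the index gives, with reversed sign, all terms of the expansion except
    y^(n+1).\<close>
  have "x * S 2 = - (\<Sum>k\<le>n. f (Suc k))"
    unfolding S_def f_def sum_distrib_left sum_negf[symmetric]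
    by (intro sum.cong refl) (simp add: algebra_simps)
  moreover have "sum f {..Suc n} = y ^ Suc n + (\<Sum>k\<le>n. f (Suc k))"
    by (subst sum.atMost_Suc_shift) (simp add: f_def)
  ultimately show B: "x * S 2 = y ^ (n + 1) - (x + y) ^ (n + 1)"
    using f by simp
  \<comment> \<open>The weights differ by 1, which leaves the cofactor of -x - y in (-x)^(n+1) -
    y^(n+1).\<close>
  have "S 2 - S 1 = (\<Sum>a<Suc n. (-x) ^ a * y ^ (n - a))"
    unfolding S_def sum_subtractf[symmetric] lessThan_Suc_atMost
    by (intro sum.cong refl) (simp add: algebra_simps power_minus[of x])
  moreover have "(-x) ^ Suc n - y ^ Suc n = (-x - y) * (\<Sum>a<Suc n. (-x) ^ a * y ^ (n - a))"
    by (rule diff_power_eq_sum)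
  ultimately have "(-x) ^ Suc n - y ^ Suc n = (-x - y) * (S 2 - S 1)"
    by simp
  moreover have "(-x) ^ Suc n = - (x ^ Suc n)"
    using n(2) by simp
  ultimately have C: "(x + y) * (S 2 - S 1) = x ^ (n + 1) + y ^ (n + 1)"
    by (simp add: algebra_simps)
  define X Y P where XYP: "X = x ^ (n + 1)" "Y = y ^ (n + 1)" "P = (x + y) ^ (n + 1)"
  note ABC = A[folded XYP] B[folded XYP] C[folded XYP]
  have "y * S 2 - x * S 1 = y * S 1 - x * S 2 + (x + y) * (S 2 - S 1)"
    by (simp add: algebra_simps)
  also have "\<dots> = 2 * P"
    unfolding ABC by simp
  finally show "y * S 2 - x * S 1 = 2 * (x + y) ^ (n + 1)"
    unfolding XYP .
  have "x * y * (S 2 - S 1) = y * (x * S 2) - x * (y * S 1)"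
    by (simp add: algebra_simps)
  hence D: "x * y * (S 2 - S 1) = y * (Y - P) - x * (P - X)"
    unfolding ABC .
  have "y * (x * S 1 + y * S 2) = (x + y) * (y * S 1) + y * ((x + y) * (S 2 - S 1)) - x * y * (S 2 - S 1)"
    by (simp add: algebra_simps)
  also have "\<dots> = 2 * ((x + y) * P - x * X)"
    unfolding ABC D by (simp add: algebra_simps)
  finally show "y * (x * S 1 + y * S 2) = 2 * ((x + y) ^ (n + 2) - x ^ (n + 2))"
    unfolding XYP by simp
  have "x * (x * S 1 + y * S 2) = (x + y) * (x * S 2) - x * ((x + y) * (S 2 - S 1)) + x * y * (S 2 - S 1)"
    by (simp add: algebra_simps)
  also have "\<dots> = 2 * (y * Y - (x + y) * P)"
    unfolding ABC D by (simp add: algebra_simps)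
  finally show "x * (x * S 1 + y * S 2) = 2 * (y ^ (n + 2) - (x + y) ^ (n + 2))"
    unfolding XYP by simp
qed

section \<open>The cochains e^{1,p} and \<phi>_k: closedness and the *-property\<close>

lemma e2_in_C2: "e2 i j \<in> C2"
  by (simp add: C2_def linear_m0_iff e2_def algebra_simps)

text \<open>For p \<ge> 3 the closed form of the star sum is the defect of additivity of g_1^(p-1)
  g_2. That form divides by 2, so p = 2 is evaluated directly.\<close>

lemma star_property_e2_1_CHAR:
  assumes "prime CHAR('a::field)"
  shows "star_property (e2 1 CHAR('a)) (\<lambda>g :: 'a m0. coord g 1 ^ (CHAR('a) - 1) * coord g 2)"
proof (cases "CHAR('a) = 2")
  case True
  \<comment> \<open>The only sequence is (g, h), and the left bracket of the single entry g is g
    itself.\<close>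
  have set: "{s. length s = CHAR('a) \<and> s ! 0 \<and> \<not> s ! 1} = {[True, False]}"
    unfolding True by (auto simp: length_Suc_conv eval_nat_numeral)
  have "star_sum (e2 1 CHAR('a)) g h = e2 1 CHAR('a) g h" for g h :: "'a m0"
    unfolding star_sum_def set by (simp add: left_bracket_def)
  \<comment> \<open>The defect of g_1 g_2 is g_1 h_2 + g_2 h_1, which is e^{1,2}(g, h) once signs
    are irrelevant.\<close>
  moreover have "x + x = 0" for x :: 'a
    using of_nat_CHAR[where 'a='a] unfolding True by (simp flip: mult_2)
  hence "- x = x" for x :: 'a
    by (simp add: neg_eq_iff_add_eq_0)
  ultimately show ?thesis
    unfolding star_property_def
    by (simp add: True e2_def diff_conv_add_uminus algebra_simps power2_eq_square del: add_uminus_conv_diff)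
next
  case False
  hence p3: "3 \<le> CHAR('a)"
    using prime_ge_2_nat[OF assms] by simp
  define n where "n = CHAR('a) - 3"
  have n: "CHAR('a) = n + 3" "CHAR('a) - 1 = n + 2"
    using p3 by (auto simp: n_def)
  show ?thesis
    unfolding star_property_def
  proof (intro conjI allI)
    fix c :: 'a and g :: "'a m0"
    have "c ^ CHAR('a) = c ^ (CHAR('a) - 1) * c"
      using p3 power_Suc2[of c "CHAR('a) - 1"] by simp
    thus "coord (m0_scale c g) 1 ^ (CHAR('a) - 1) * coord (m0_scale c g) 2 =
        c ^ CHAR('a) * (coord g 1 ^ (CHAR('a) - 1) * coord g 2)"
      by (simp add: power_mult_distrib)
  next
    fix g h :: "'a m0"
    define x y u v where "x = coord g 1" "y = coord h 1" "u = coord g 2" "v = coord h 2"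
    define S where "S = (\<lambda>c. \<Sum>a\<le>n. (-1) ^ a * of_nat (a + c) * x ^ a * y ^ (n - a))"
    have S: "y * (x * S 1 + y * S 2) = 2 * ((x + y) ^ (n + 2) - x ^ (n + 2))"
      "x * (x * S 1 + y * S 2) = 2 * (y ^ (n + 2) - (x + y) ^ (n + 2))"
      unfolding S_def n_def by (rule alternating_power_sums(4,5)[OF assms p3])+
    have ep: "e2 1 CHAR('a) (e CHAR('a)) k = - coord k 1" for k :: "'a m0"
      using p3 by (simp add: e2_def coord_e)
    have star: "star_sum (e2 1 CHAR('a)) g h = (x * v - u * y) / 2 * (S 1 * - x + S 2 * - y)"
      unfolding star_sum_eq[OF assms p3 e2_in_C2] ep n_def[symmetric] S_def x_y_u_v_def ..
    have two: "(2::'a) \<noteq> 0"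
      using CHAR_prime_ge_3_facts(2)[OF assms p3] .
    have "2 * star_sum (e2 1 CHAR('a)) g h = (x * v - u * y) * (S 1 * - x + S 2 * - y)"
      unfolding star using two by simp
    \<comment> \<open>Regrouped into the two products evaluated by the last two identities of
      \<open>alternating_power_sums\<close>.\<close>
    also have "\<dots> = u * (y * (x * S 1 + y * S 2)) - v * (x * (x * S 1 + y * S 2))"
      by (simp add: algebra_simps)
    also have "\<dots> = 2 * (u * ((x + y) ^ (n + 2) - x ^ (n + 2)) - v * (y ^ (n + 2) - (x + y) ^ (n + 2)))"
      unfolding S by (simp add: algebra_simps del: power_Suc add_2_eq_Suc')
    finally have "star_sum (e2 1 CHAR('a)) g h = u * ((x + y) ^ (n + 2) - x ^ (n + 2)) - v * (y ^ (n + 2) - (x + y) ^ (n + 2))"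
      using two mult_cancel_left by blast
    thus "coord (g + h) 1 ^ (CHAR('a) - 1) * coord (g + h) 2 = coord g 1 ^ (CHAR('a) - 1) * coord g 2 +
        coord h 1 ^ (CHAR('a) - 1) * coord h 2 + star_sum (e2 1 CHAR('a)) g h"
      unfolding n(2) coord_simps x_y_u_v_def[symmetric] by (simp add: algebra_simps)
  qed
qed

lemma \<phi>_odd_in_C2: "\<phi>_odd k \<in> C2"
  by (simp add: C2_def linear_m0_iff \<phi>_odd_def e2_def sum.distrib sum_distrib_left algebra_simps sum_subtractf)

text \<open>For odd \<open>k\<close>, the swap \<open>i \<mapsto> k - i\<close> turns the antisymmetrised half sum into a full sum along an antidiagonal.\<close>

lemma \<phi>_odd_eq_antidiagonal_sum:
  assumes "odd k" "5 \<le> k"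
  shows "\<phi>_odd k g h = (\<Sum>i = 2..k - 2. (-1) ^ i * coord g i * coord h (k - i))"
proof -
  define m where "m = k div 2"
  have k: "k = 2 * m + 1"
    using assms by (auto simp: m_def)
  have "(\<Sum>i = 2..m. (-1) ^ i * coord g (k - i) * coord h i) =
      (\<Sum>i = m + 1..k - 2. - ((-1) ^ i * coord g i * coord h (k - i)))"
  proof (rule sum.reindex_bij_witness[of _ "\<lambda>i. k - i" "\<lambda>i. k - i"])
    fix i assume i: "i \<in> {2..m}"
    have "(-1 :: 'a) ^ (k - i) * (-1) ^ i = (-1) ^ k"
      using i k by (simp flip: power_add)
    hence "(-1 :: 'a) ^ (k - i) = - ((-1) ^ i)"
      using assms(1) by (simp add: minus_one_power_iff split: if_splits)
    thus "- ((-1) ^ (k - i) * coord g (k - i) * coord h (k - (k - i))) = (-1) ^ i * coord g (k - i) * coord h i"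
      using i k by simp
  qed (use k in auto)
  moreover have "{2..k - 2} = {2..m} \<union> {m + 1..k - 2}"
    using k assms by auto
  hence "(\<Sum>i = 2..k - 2. (-1) ^ i * coord g i * coord h (k - i)) =
      (\<Sum>i = 2..m. (-1) ^ i * coord g i * coord h (k - i)) + (\<Sum>i = m + 1..k - 2. (-1) ^ i * coord g i * coord h (k - i))"
    by (simp add: sum.union_disjoint)
  ultimately show ?thesis
    unfolding \<phi>_odd_def e2_def m_def[symmetric]
    by (simp add: algebra_simps sum_subtractf sum_negf)
qed

lemma \<phi>_odd_e:
  assumes "odd k" "5 \<le> k" "i \<in> {1..CHAR('a::field)}"
  shows "\<phi>_odd k (e i) h = (if 2 \<le> i \<and> i \<le> k - 2 then (-1) ^ i * coord (h :: 'a m0) (k - i) else 0)"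
proof -
  have "\<phi>_odd k (e i) h = (\<Sum>l = 2..k - 2. if i = l then (-1) ^ l * coord h (k - l) else 0)"
    unfolding \<phi>_odd_eq_antidiagonal_sum[OF assms(1,2)] using assms(3)
    by (intro sum.cong) (auto simp: coord_e)
  thus ?thesis
    by simp
qed

text \<open>\<open>T\<close> sums with alternating signs along i + j = k - 1. As k - 1 is even,
  \<open>T\<close> is symmetric, and the terms of the cocycle identity, each a first coordinate
  times a value of \<open>T\<close>, cancel in pairs.\<close>

lemma d2_\<phi>_odd:
  assumes "odd k" "5 \<le> k" "k \<le> CHAR('a::field) + 2"
  shows "d2 (\<phi>_odd k :: 'a m0 \<Rightarrow> 'a m0 \<Rightarrow> 'a) = 0"
proof -
  define T where "T = (\<lambda>x y :: 'a m0. \<Sum>j = 2..k - 3. (-1) ^ j * coord x j * coord y (k - 1 - j))"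
  have T_sym: "T x y = T y x" for x y
    unfolding T_def
  proof (rule sum.reindex_bij_witness[of _ "\<lambda>j. k - 1 - j" "\<lambda>j. k - 1 - j"])
    fix j assume j: "j \<in> {2..k - 3}"
    hence "even (k - 1 - j) = even j"
      using assms by auto
    hence "(-1 :: 'a) ^ (k - 1 - j) = (-1) ^ j"
      by (simp only: minus_one_power_iff)
    moreover have "k - 1 - (k - 1 - j) = j"
      using j assms by auto
    ultimately show "(-1) ^ (k - 1 - j) * coord y (k - 1 - j) * coord x (k - 1 - (k - 1 - j)) =
        (-1) ^ j * coord x j * coord y (k - 1 - j)"
      by (simp only: mult_ac)
  qed (use assms in auto)
  have \<phi>: "\<phi>_odd k (bracket g h) f = coord h 1 * T g f - coord g 1 * T h f" for g h f :: "'a m0"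
  proof -
    define F where "F = (\<lambda>i. (-1) ^ i * coord (bracket g h) i * coord f (k - i))"
    have "\<phi>_odd k (bracket g h) f = sum F {2..k - 2}"
      unfolding \<phi>_odd_eq_antidiagonal_sum[OF assms(1,2)] F_def ..
    also have "\<dots> = F 2 + sum F {Suc 2..k - 2}"
      using assms by (intro sum.atLeast_Suc_atMost) simp
    also have "F 2 = 0"
      by (simp add: F_def coord_bracket)
    also have "k - 2 = Suc (k - 3)"
      using assms by simp
    also have "0 + sum F {Suc 2..Suc (k - 3)} = (\<Sum>j = 2..k - 3. F (Suc j))"
      unfolding sum.shift_bounds_cl_Suc_ivl by simp
    finally have "\<phi>_odd k (bracket g h) f = (\<Sum>j = 2..k - 3. (-1) ^ Suc j * coord (bracket g h) (Suc j) * coord f (k - Suc j))"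
      unfolding F_def .
    \<comment> \<open>Since k \<le> p + 2, every index \<open>Suc j\<close> is at most p, so no
      bracket coordinate is cut off.\<close>
    also have "\<dots> = (\<Sum>j = 2..k - 3. coord h 1 * ((-1) ^ j * coord g j * coord f (k - 1 - j)) -
        coord g 1 * ((-1) ^ j * coord h j * coord f (k - 1 - j)))"
      using assms(3) by (intro sum.cong) (auto simp: coord_bracket algebra_simps)
    finally show ?thesis
      by (simp add: T_def sum_subtractf sum_distrib_left)
  qed
  show ?thesis
  proof (intro ext)
    fix g h f :: "'a m0"
    show "d2 (\<phi>_odd k) g h f = 0 g h f"
      unfolding d2_def \<phi> using T_sym[of f g] T_sym[of f h] T_sym[of g h] by (simp add: algebra_simps)
  qed
qed

text \<open>Brackets have no e_1-component, so each term is the e_p-coordinate of a bracket times a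
  first coordinate; expanded, they cancel in pairs.\<close>

lemma d2_e2_1_CHAR: "d2 (e2 1 CHAR('a) :: 'a::field m0 \<Rightarrow> 'a m0 \<Rightarrow> 'a) = 0"
  by (intro ext) (simp add: d2_def e2_def coord_bracket algebra_simps)

text \<open>This antidiagonal reaches e_p and pairs it with e_2, so the star sum is quadratic in the
  second coordinates; the first three identities of \<open>alternating_power_sums\<close> turn it
  into the defect of additivity of the given map.\<close>

lemma star_property_\<phi>_odd_top:
  assumes "prime CHAR('a::field)" "3 \<le> CHAR('a)"
  shows "star_property (\<phi>_odd (CHAR('a) + 2)) (\<lambda>g :: 'a m0. coord g 1 ^ (CHAR('a) - 2) * coord g 2 ^ 2 / 2)"
proof -
  define n where "n = CHAR('a) - 3"
  have n: "CHAR('a) = n + 3" "CHAR('a) - 2 = n + 1"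
    using assms by (auto simp: n_def)
  have two: "(2::'a) \<noteq> 0" and odd: "odd CHAR('a)"
    using CHAR_prime_ge_3_facts[OF assms] by auto
  show ?thesis
    unfolding star_property_def
  proof (intro conjI allI)
    fix c :: 'a and g :: "'a m0"
    have "CHAR('a) - 2 + 2 = CHAR('a)"
      using assms(2) by simp
    hence "c ^ CHAR('a) = c ^ (CHAR('a) - 2) * c ^ 2"
      by (metis power_add)
    thus "coord (m0_scale c g) 1 ^ (CHAR('a) - 2) * coord (m0_scale c g) 2 ^ 2 / 2 =
        c ^ CHAR('a) * (coord g 1 ^ (CHAR('a) - 2) * coord g 2 ^ 2 / 2)"
      by (simp add: power_mult_distrib)
  next
    fix g h :: "'a m0"
    let ?\<phi> = "\<phi>_odd (CHAR('a) + 2) :: 'a m0 \<Rightarrow> 'a m0 \<Rightarrow> 'a"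
    define x y u v where "x = coord g 1" "y = coord h 1" "u = coord g 2" "v = coord h 2"
    define S where "S = (\<lambda>c. \<Sum>a\<le>n. (-1) ^ a * of_nat (a + c) * x ^ a * y ^ (n - a))"
    have S: "y * S 1 = (x + y) ^ (n + 1) - x ^ (n + 1)" "x * S 2 = y ^ (n + 1) - (x + y) ^ (n + 1)"
      "y * S 2 - x * S 1 = 2 * (x + y) ^ (n + 1)"
      unfolding S_def n_def by (rule alternating_power_sums(1-3)[OF assms])+
    have ep: "?\<phi> (e CHAR('a)) k = - coord k 2" for k :: "'a m0"
      using \<phi>_odd_e[of "CHAR('a) + 2" "CHAR('a)" k] odd assms by simp
    have star: "star_sum ?\<phi> g h = (x * v - u * y) / 2 * (S 1 * - u + S 2 * - v)"
      unfolding star_sum_eq[OF assms \<phi>_odd_in_C2] ep n_def[symmetric] S_def x_y_u_v_def ..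
    have "2 * star_sum ?\<phi> g h = (x * v - u * y) * (S 1 * - u + S 2 * - v)"
      unfolding star using two by simp
    also have "\<dots> = u^2 * (y * S 1) - v^2 * (x * S 2) + u * v * (y * S 2 - x * S 1)"
      by (simp add: algebra_simps power2_eq_square)
    also have "\<dots> = (x + y) ^ (n + 1) * (u + v)^2 - x ^ (n + 1) * u^2 - y ^ (n + 1) * v^2"
      unfolding S power2_sum by (simp add: algebra_simps del: power_Suc)
    finally have "star_sum ?\<phi> g h = (x + y) ^ (n + 1) * (u + v)^2 / 2 - x ^ (n + 1) * u^2 / 2 - y ^ (n + 1) * v^2 / 2"
      by (simp only: diff_divide_distrib[symmetric] nonzero_eq_divide_eq[OF two] mult.commute)
    thus "coord (g + h) 1 ^ (CHAR('a) - 2) * coord (g + h) 2 ^ 2 / 2 = coord g 1 ^ (CHAR('a) - 2) * coord g 2 ^ 2 / 2 +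
        coord h 1 ^ (CHAR('a) - 2) * coord h 2 ^ 2 / 2 + star_sum ?\<phi> g h"
      unfolding n(2) coord_simps x_y_u_v_def[symmetric] by simp
  qed
qed

lemma star_property_zero:
  assumes "prime CHAR('a::field)" "3 \<le> CHAR('a)" "\<phi> \<in> C2" "\<And>h :: 'a m0. \<phi> (e CHAR('a)) h = 0"
  shows "star_property \<phi> (\<lambda>_. 0)"
  unfolding star_property_def star_sum_eq[OF assms(1-3)] assms(4) by simp

section \<open>Expansion in the basis\<close>

lemma m0_expansion: "g = (\<Sum>i = 1..CHAR('a). m0_scale (coord g i) (e i :: 'a::field m0))"
proof (rule m0_eqI)
  fix j
  have "coord (\<Sum>i = 1..CHAR('a). m0_scale (coord g i) (e i :: 'a m0)) j =
      (\<Sum>i = 1..CHAR('a). if j = i then coord g i else 0)"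
    unfolding coord_sum by (intro sum.cong) (auto simp: coord_e)
  thus "coord g j = coord (\<Sum>i = 1..CHAR('a). m0_scale (coord g i) (e i :: 'a m0)) j"
    using coord_outside[of j g] by auto
qed

text \<open>The star sums cancel in the difference, which is therefore additive and scales by c^p,
  hence is determined on the basis.\<close>

lemma star_property_unique:
  fixes \<omega> \<omega>' :: "'a::field m0 \<Rightarrow> 'a"
  assumes "CHAR('a) > 0" "star_property \<phi> \<omega>" "star_property \<phi> \<omega>'"
    and "\<And>k. k \<in> {1..CHAR('a)} \<Longrightarrow> \<omega> (e k) = \<omega>' (e k)"
  shows "\<omega> = \<omega>'"
proof
  fix g
  define f where "f = (\<lambda>x. \<omega> x - \<omega>' x)"
  have add: "f (x + y) = f x + f y" and scale: "f (m0_scale c x) = c ^ CHAR('a) * f x" for x y c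
    using assms(2,3) by (simp_all add: f_def star_property_def algebra_simps)
  have zero: "f 0 = 0"
    using scale[of 0 0] assms(1) by (simp add: power_0_left)
  have sum: "f (sum h A) = (\<Sum>a\<in>A. f (h a))" for h and A :: "nat set"
    by (induction A rule: infinite_finite_induct) (simp_all add: zero add)
  have "f g = (\<Sum>i = 1..CHAR('a). f (m0_scale (coord g i) (e i)))"
    by (subst m0_expansion[of g]) (rule sum)
  also have "\<dots> = 0"
  proof (rule sum.neutral, rule ballI)
    fix i assume "i \<in> {1..CHAR('a)}"
    hence "f (e i) = 0"
      using assms(4) by (simp add: f_def)
    thus "f (m0_scale (coord g i) (e i)) = 0"
      by (simp add: scale)
  qed
  finally show "\<omega> g = \<omega>' g"
    by (simp add: f_def)
qed

lemma tilde_eqI: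
  fixes \<omega> :: "'a::field m0 \<Rightarrow> 'a"
  assumes "CHAR('a) > 0" "star_property \<phi> \<omega>" "\<And>k. k \<in> {1..CHAR('a)} \<Longrightarrow> \<omega> (e k) = 0"
  shows "tilde \<phi> = \<omega>"
  unfolding tilde_def
  using assms star_property_unique[OF assms(1)] by (intro the_equality) auto

text \<open>\<open>\<omega>\<close> is the witness that makes the definite description in
  \<open>tilde\<close> denote; the conclusions speak of \<open>tilde\<close> alone.\<close>

lemma tilde_props:
  fixes \<omega> :: "'a::field m0 \<Rightarrow> 'a"
  assumes "CHAR('a) > 0" "star_property \<phi> \<omega>" "\<And>k. k \<in> {1..CHAR('a)} \<Longrightarrow> \<omega> (e k) = 0"
  shows "star_property \<phi> (tilde \<phi>)" and "k \<in> {1..CHAR('a)} \<Longrightarrow> tilde \<phi> (e k) = 0"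
  using assms tilde_eqI[OF assms] by auto

lemma tilde_e2_1_CHAR:
  assumes "prime CHAR('a::field)"
  shows "star_property (e2 1 CHAR('a)) (tilde (e2 1 CHAR('a)) :: 'a m0 \<Rightarrow> 'a)"
    and "k \<in> {1..CHAR('a)} \<Longrightarrow> tilde (e2 1 CHAR('a)) (e k :: 'a m0) = 0"
  using tilde_props[OF prime_gt_0_nat[OF assms] star_property_e2_1_CHAR[OF assms]]
    prime_ge_2_nat[OF assms] by (auto simp: coord_e power_0_left)

lemma tilde_\<phi>_odd:
  assumes "prime CHAR('a::field)" "odd k" "5 \<le> k" "k \<le> CHAR('a) + 2"
  shows "star_property (\<phi>_odd k) (tilde (\<phi>_odd k) :: 'a m0 \<Rightarrow> 'a)"
    and "j \<in> {1..CHAR('a)} \<Longrightarrow> tilde (\<phi>_odd k) (e j :: 'a m0) = 0"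
proof -
  have p3: "3 \<le> CHAR('a)"
    using assms by simp
  have "\<exists>\<omega> :: 'a m0 \<Rightarrow> 'a. star_property (\<phi>_odd k) \<omega> \<and> (\<forall>j \<in> {1..CHAR('a)}. \<omega> (e j) = 0)"
  proof (cases "k = CHAR('a) + 2")
    case True
    show ?thesis
      unfolding True by (rule exI, rule conjI[OF star_property_\<phi>_odd_top[OF assms(1) p3]])
        (use p3 in \<open>auto simp: coord_e power_0_left\<close>)
  next
    case False
    \<comment> \<open>For k < p + 2 the index p lies outside 2..k - 2, so the zero map has the
      *-property.\<close>
    hence "\<phi>_odd k (e CHAR('a)) h = 0" for h :: "'a m0"
      using assms by (subst \<phi>_odd_e) auto
    thus ?thesis
      using star_property_zero[OF assms(1) p3 \<phi>_odd_in_C2] by blast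
  qed
  thus "star_property (\<phi>_odd k) (tilde (\<phi>_odd k) :: 'a m0 \<Rightarrow> 'a)"
    and "j \<in> {1..CHAR('a)} \<Longrightarrow> tilde (\<phi>_odd k) (e j :: 'a m0) = 0"
    using tilde_props[OF prime_gt_0_nat[OF assms(1)], of "\<phi>_odd k"] by blast+
qed

section \<open>Cocycles and coboundaries\<close>

text \<open>As \<open>e\<close> is 0 beyond index p, the rule continues there with both sides 0, and
  antidiagonals can be followed without boundary cases.\<close>

lemma bracket_e1_e:
  assumes "2 \<le> i"
  shows "bracket (e 1) (e i) = (e (i + 1) :: 'a::field m0)"
  by (rule m0_eqI) (use assms in \<open>auto simp: coord_bracket coord_e\<close>)

lemma bracket_e_e:
  assumes "2 \<le> i" "2 \<le> j"
  shows "bracket (e i) (e j) = (0 :: 'a::field m0)"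
  by (rule m0_eqI) (use assms in \<open>auto simp: coord_bracket coord_e\<close>)

lemma e_eq_0: "i \<notin> {1..CHAR('a)} \<Longrightarrow> e i = (0 :: 'a::field m0)"
  by (rule m0_eqI) (auto simp: coord_e)

text \<open>
  Evaluated at \<open>(e\<^sub>1, e\<^sub>i, e\<^sub>j)\<close>, the cocycle identity says that \<open>\<phi>(e\<^sub>i, e\<^sub>j)\<close> changes sign under
  \<open>(i + 1, j) \<mapsto> (i, j + 1)\<close>.  Hence on each antidiagonal \<open>\<phi>\<close> is determined by its value at \<open>(e\<^sub>2, _)\<close>,
  and vanishes on the antidiagonals that meet the diagonal.
\<close>

lemma cocycle_vanishes:
  fixes \<phi> :: "'a::field m0 \<Rightarrow> 'a m0 \<Rightarrow> 'a"
  assumes C2: "\<phi> \<in> C2" and d2: "d2 \<phi> = 0"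
    and zero: "\<And>j. odd j \<Longrightarrow> 3 \<le> j \<Longrightarrow> j \<le> CHAR('a) \<Longrightarrow> \<phi> (e 2) (e j) = 0"
    and "2 \<le> i" "2 \<le> j"
  shows "\<phi> (e i) (e j) = 0"
proof -
  have step: "\<phi> (e (i + 1)) (e j) = - \<phi> (e i) (e (j + 1))" if "2 \<le> i" "2 \<le> j" for i j
  proof -
    have "d2 \<phi> (e 1) (e i) (e j) = 0"
      using d2 by simp
    hence "\<phi> (e (i + 1)) (e j) = \<phi> (e (j + 1)) (e i)"
      unfolding d2_def bracket_e1_e[OF that(1)] bracket_e1_e[OF that(2)] bracket_e_e[OF that]
      by (simp add: C2_simps(6)[OF C2])
    thus ?thesis
      using C2_simps(8)[OF C2, of "e (j + 1)" "e i"] by simp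
  qed
  have shift: "\<phi> (e (2 + m)) (e j) = (-1) ^ m * \<phi> (e 2) (e (j + m))" if "2 \<le> j" for m j
    using that
  proof (induction m arbitrary: j)
    case (Suc m)
    show ?case
      using step[of "2 + m" j] Suc.IH[of "j + 1"] Suc.prems by simp
  qed simp
  have row: "\<phi> (e 2) (e j) = 0" if "2 \<le> j" for j
  proof (cases "even j")
    case True
    then obtain c where c: "j = 2 * c"
      by blast
    \<comment> \<open>From (2, 2c), c - 1 shifts lead to the diagonal, where an alternating form
      vanishes.\<close>
    have "\<phi> (e (c + 1)) (e (c + 1)) = (-1) ^ (c - 1) * \<phi> (e 2) (e j)"
      using shift[of "c + 1" "c - 1"] c that by (simp add: mult_2)
    thus ?thesis
      by (simp add: C2_simps(5)[OF C2])
  next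
    case False
    have "3 \<le> j"
      using False that by (cases "j = 2") auto
    thus ?thesis
      using zero[OF False] e_eq_0[of j, where 'a='a] C2_simps(7)[OF C2] by (cases "j \<le> CHAR('a)") auto
  qed
  have "2 + (i - 2) = i"
    using assms(4) by simp
  thus ?thesis
    using shift[of j "i - 2"] row[of "j + (i - 2)"] assms(4,5) by (simp del: add_2_eq_Suc add_2_eq_Suc')
qed

lemma C2_eqI:
  fixes \<phi> \<phi>' :: "'a::field m0 \<Rightarrow> 'a m0 \<Rightarrow> 'a"
  assumes "\<phi> \<in> C2" "\<phi>' \<in> C2"
    and "\<And>i j. 1 \<le> i \<Longrightarrow> i < j \<Longrightarrow> j \<le> CHAR('a) \<Longrightarrow> \<phi> (e i) (e j) = \<phi>' (e i) (e j)"
  shows "\<phi> = \<phi>'"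
proof (intro ext)
  fix g h
  have sums: "\<chi> (sum f A) y = (\<Sum>a\<in>A. \<chi> (f a) y)" "\<chi> x (sum f A) = (\<Sum>a\<in>A. \<chi> x (f a))"
    if "\<chi> \<in> C2" for \<chi> :: "'a m0 \<Rightarrow> 'a m0 \<Rightarrow> 'a" and f :: "nat \<Rightarrow> 'a m0" and A x y
    by (induction A rule: infinite_finite_induct) (simp_all add: C2_simps(1,2,6,7)[OF that])
  have expand: "\<chi> g h = (\<Sum>i = 1..CHAR('a). \<Sum>j = 1..CHAR('a). coord g i * (coord h j * \<chi> (e i) (e j)))"
    if "\<chi> \<in> C2" for \<chi> :: "'a m0 \<Rightarrow> 'a m0 \<Rightarrow> 'a"
  proof -
    have "\<chi> g h = \<chi> (\<Sum>i = 1..CHAR('a). m0_scale (coord g i) (e i)) (\<Sum>i = 1..CHAR('a). m0_scale (coord h i) (e i))"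
      using m0_expansion[of g] m0_expansion[of h] by simp
    also have "\<dots> = (\<Sum>i = 1..CHAR('a). coord g i * \<chi> (e i) (\<Sum>i = 1..CHAR('a). m0_scale (coord h i) (e i)))"
      by (simp only: sums(1)[OF that] C2_simps(3)[OF that])
    finally show ?thesis
      by (simp only: sums(2)[OF that] C2_simps(4)[OF that] sum_distrib_left)
  qed
  have "\<phi> (e i) (e j) = \<phi>' (e i) (e j)" if "i \<in> {1..CHAR('a)}" "j \<in> {1..CHAR('a)}" for i j
  proof (cases i j rule: linorder_cases)
    case less
    thus ?thesis
      using assms(3) that by simp
  next
    case equal
    thus ?thesis
      using C2_simps(5) assms(1,2) by metis
  next
    case greater
    thus ?thesis
      using assms(3)[of j i] that C2_simps(8)[OF assms(1), of "e i" "e j"] C2_simps(8)[OF assms(2), of "e i" "e j"]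
      by simp
  qed
  thus "\<phi> g h = \<phi>' g h"
    unfolding expand[OF assms(1)] expand[OF assms(2)] by simp
qed

lemma pmap_zero: "pmap (\<lambda>_. 0) g = (0 :: 'a::field m0)"
  by (rule m0_eqI) (simp add: pmap_def)

lemma Z2_res_zero_iff:
  "x \<in> Z2_res (\<lambda>_. 0) \<longleftrightarrow> fst x \<in> C2 \<and> star_property (fst x) (snd x) \<and> d2 (fst x) = 0"
  unfolding Z2_res_def C2_res_def d2_res_def
  by (auto simp: ind2_def pmap_zero fun_eq_iff zero_prod_def C2_simps(7))

section \<open>The claimed basis and its dual functionals\<close>

datatype basis_index = Frobenius nat | Top | Antidiagonal nat

text \<open>Labels make duality a Kronecker delta, which also yields that the cocycles are distinct.
  For p = 2 the antidiagonal family is empty.\<close>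

definition basis_indices :: "nat \<Rightarrow> basis_index set" where
  "basis_indices p = Frobenius ` {1..p} \<union> {Top} \<union> Antidiagonal ` {k. odd k \<and> 5 \<le> k \<and> k \<le> p + 2}"

fun basis_cocycle :: "basis_index \<Rightarrow> 'a::field cochain2" where
  "basis_cocycle (Frobenius k) = (0, ebar k)"
| "basis_cocycle Top = (e2 1 CHAR('a), tilde (e2 1 CHAR('a)))"
| "basis_cocycle (Antidiagonal k) = (\<phi>_odd k, tilde (\<phi>_odd k))"

text \<open>\<phi>_k begins with e^{2,k-2} with coefficient (-1)^2 = 1, hence the evaluation at
  (e_2, e_{k-2}).\<close>

fun dual_functional :: "basis_index \<Rightarrow> 'a::field cochain2 \<Rightarrow> 'a" where
  "dual_functional (Frobenius k) x = snd x (e k)"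
| "dual_functional Top x = fst x (e 1) (e CHAR('a))"
| "dual_functional (Antidiagonal k) x = fst x (e 2) (e (k - 2))"

lemma finite_basis_indices: "finite (basis_indices p)"
  unfolding basis_indices_def by simp

lemma card_basis_indices: "card (basis_indices p) = p + 1 + (p - 1) div 2"
proof -
  have "{k. odd k \<and> 5 \<le> k \<and> k \<le> p + 2} = (\<lambda>m. 2 * m + 5) ` {..<(p - 1) div 2}" (is "?A = _")
  proof (intro equalityI subsetI)
    fix k assume "k \<in> ?A"
    moreover from this obtain c where "k = 2 * c + 1"
      by (auto elim: oddE)
    ultimately have "k = 2 * (c - 2) + 5" "c - 2 < (p - 1) div 2"
      by auto
    thus "k \<in> (\<lambda>m. 2 * m + 5) ` {..<(p - 1) div 2}"
      by blast
  qed auto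
  hence "card ?A = (p - 1) div 2"
    by (simp add: card_image inj_on_def)
  moreover have "finite ?A"
    by simp
  ultimately show ?thesis
    unfolding basis_indices_def
    by (subst card_Un_disjoint; (subst card_Un_disjoint)?) (auto simp: card_image inj_on_def)
qed

lemma dual_functional_linear:
  "dual_functional i (x + y) = dual_functional i x + dual_functional i y"
  "dual_functional i (x - y) = dual_functional i x - dual_functional i y"
  "dual_functional i (scale2 c x) = c * dual_functional i x"
  "dual_functional i 0 = 0"
  by (cases i; simp add: scale2_def)+

lemma dual_functional_sum: "dual_functional i (sum f A) = (\<Sum>a\<in>A. dual_functional i (f a))"
  by (induction A rule: infinite_finite_induct) (simp_all add: dual_functional_linear)

lemma C1_zero:
  assumes "\<psi> \<in> C1"
  shows "\<psi> 0 = 0"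
proof -
  have "\<psi> (m0_scale 0 0) = 0 * \<psi> 0"
    using assms unfolding C1_def linear_m0_iff by blast
  thus ?thesis
    by simp
qed

text \<open>Each functional evaluates at a pair with zero bracket or at a value of the zero p-map;
  so it descends to cohomology classes.\<close>

lemma dual_functional_B2_res:
  assumes "x \<in> B2_res (\<lambda>_. 0)" "i \<in> basis_indices CHAR('a::field)"
  shows "dual_functional i (x :: 'a cochain2) = 0"
proof -
  obtain \<psi> where \<psi>: "\<psi> \<in> C1" "x = d1_res (\<lambda>_. 0) \<psi>"
    using assms(1) unfolding B2_res_def by blast
  have zero: "\<psi> 0 = 0"
    using \<psi>(1) by (rule C1_zero)
  have "bracket (e 1) (e CHAR('a)) = (0 :: 'a m0)"
    by (rule bracket_e_eq_0) auto
  moreover have "bracket (e 2) (e j) = (0 :: 'a m0)" if "3 \<le> j" for j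
    using that by (intro bracket_e_e) auto
  ultimately show ?thesis
    using assms(2) by (auto simp: basis_indices_def \<psi>(2) d1_res_def d1_def ind1_def pmap_zero zero)
qed

lemma basis_cocycle_in_Z2_res:
  assumes "prime CHAR('a::field)" "i \<in> basis_indices CHAR('a)"
  shows "(basis_cocycle i :: 'a cochain2) \<in> Z2_res (\<lambda>_. 0)"
proof (cases i)
  case (Frobenius k)
  have "star_sum 0 g h = 0" for g h :: "'a m0"
    by (simp add: star_sum_def)
  \<comment> \<open>Without a correction term the *-property is plain additivity, which is the
    Frobenius identity.\<close>
  hence "star_property 0 (ebar k :: 'a m0 \<Rightarrow> 'a)"
    using freshmans_dream[OF assms(1) refl] by (simp add: star_property_def ebar_def power_mult_distrib)
  moreover have "0 \<in> C2" "d2 0 = 0"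
    by (simp_all add: C2_def linear_m0_iff d2_def fun_eq_iff)
  ultimately show ?thesis
    unfolding Z2_res_zero_iff Frobenius by simp
next
  case Top
  show ?thesis
    unfolding Z2_res_zero_iff Top basis_cocycle.simps fst_conv snd_conv
    using e2_in_C2 tilde_e2_1_CHAR(1)[OF assms(1)] d2_e2_1_CHAR by blast
next
  case (Antidiagonal k)
  hence "odd k" "5 \<le> k" "k \<le> CHAR('a) + 2"
    using assms(2) by (auto simp: basis_indices_def)
  thus ?thesis
    unfolding Z2_res_zero_iff Antidiagonal basis_cocycle.simps fst_conv snd_conv
    using \<phi>_odd_in_C2 tilde_\<phi>_odd(1)[OF assms(1)] d2_\<phi>_odd by blast
qed

lemma dual_functional_basis_cocycle:
  assumes "prime CHAR('a::field)" "i \<in> basis_indices CHAR('a)" "j \<in> basis_indices CHAR('a)"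
  shows "dual_functional i (basis_cocycle j :: 'a cochain2) = (if i = j then 1 else 0)"
proof -
  have p: "2 \<le> CHAR('a)" "0 < CHAR('a)"
    using prime_ge_2_nat[OF assms(1)] by auto
  show ?thesis
  proof (cases j)
    case (Frobenius k)
    thus ?thesis
      using assms(2,3) p by (cases i) (auto simp: basis_indices_def ebar_def coord_e power_0_left)
  next
    case Top
    thus ?thesis
      using assms(2,3) p tilde_e2_1_CHAR(2)[OF assms(1)]
      by (cases i) (auto simp: basis_indices_def e2_def coord_e)
  next
    case (Antidiagonal k)
    hence k: "odd k" "5 \<le> k" "k \<le> CHAR('a) + 2"
      using assms(3) by (auto simp: basis_indices_def)
    show ?thesis
    proof (cases i)
      case (Frobenius l)
      hence "l \<in> {1..CHAR('a)}"
        using assms(2) by (auto simp: basis_indices_def)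
      thus ?thesis
        using tilde_\<phi>_odd(2)[OF assms(1) k] Frobenius Antidiagonal by simp
    next
      case Top
      thus ?thesis
        using \<phi>_odd_e[OF k(1,2), where i = 1 and 'a = 'a] p Antidiagonal by simp
    next
      case (Antidiagonal l)
      hence l: "5 \<le> l" "l \<le> CHAR('a) + 2"
        using assms(2) by (auto simp: basis_indices_def)
      have "\<phi>_odd k (e 2) (e (l - 2) :: 'a m0) = coord (e (l - 2) :: 'a m0) (k - 2)"
        using \<phi>_odd_e[OF k(1,2), where i = 2 and 'a = 'a] p k(2) by simp
      also have "\<dots> = (if l = k then 1 else 0)"
      proof -
        have "k - 2 = l - 2 \<longleftrightarrow> l = k" "l - 2 \<in> {1..CHAR('a)}"
          unfolding atLeastAtMost_iff using l k(2) by linarith+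
        thus ?thesis
          unfolding coord_e by simp
      qed
      finally show ?thesis
        using Antidiagonal \<open>j = Antidiagonal k\<close> by simp
    qed
  qed
qed

text \<open>With \<open>dual_functional_B2_res\<close> this makes the coboundaries the common kernel
  of the functionals on cocycles.\<close>

lemma Z2_res_with_zero_duals_in_B2_res:
  assumes "CHAR('a::field) > 0" "x \<in> Z2_res (\<lambda>_. 0)"
    and dual: "\<And>i. i \<in> basis_indices CHAR('a) \<Longrightarrow> dual_functional i (x :: 'a cochain2) = 0"
  shows "x \<in> B2_res (\<lambda>_. 0)"
proof -
  obtain \<phi> \<omega> where x: "x = (\<phi>, \<omega>)"
    by (cases x)
  have \<phi>: "\<phi> \<in> C2" "star_property \<phi> \<omega>" "d2 \<phi> = 0"
    using assms(2) unfolding Z2_res_zero_iff x by auto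
  \<comment> \<open>The primitive is forced on e_3, ..., e_p by [e_1, e_j] = e_{j+1}; on e_1 and
    e_2, which are not brackets, it is set to 0.\<close>
  define \<psi> where "\<psi> = (\<lambda>g. \<Sum>j = 3..CHAR('a). coord g j * \<phi> (e 1) (e (j - 1)))"
  have \<psi>: "\<psi> \<in> C1"
    by (simp add: C1_def linear_m0_iff \<psi>_def sum.distrib sum_distrib_left algebra_simps)
  hence B: "d1_res (\<lambda>_. 0) \<psi> \<in> B2_res (\<lambda>_. 0)"
    unfolding B2_res_def by blast
  hence "d1_res (\<lambda>_. 0) \<psi> \<in> Z2_res (\<lambda>_. 0)"
    using B2_res_subset_Z2_res[OF assms(1)] by blast
  hence Z: "d1 \<psi> \<in> C2" "star_property (d1 \<psi>) (ind1 (\<lambda>_. 0) \<psi>)"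
    unfolding d1_res_def Z2_res_zero_iff by simp_all
  have \<psi>_zero: "\<psi> 0 = 0"
    by (simp add: \<psi>_def)
  have \<psi>_e: "\<psi> (e j) = \<phi> (e 1) (e (j - 1))" if "3 \<le> j" "j \<le> CHAR('a)" for j
  proof -
    have "\<psi> (e j) = (\<Sum>l = 3..CHAR('a). if j = l then \<phi> (e 1) (e (l - 1)) else 0)"
      unfolding \<psi>_def by (intro sum.cong) (use that in \<open>auto simp: coord_e\<close>)
    thus ?thesis
      using that by simp
  qed
  have "\<phi> = d1 \<psi>"
  proof (rule C2_eqI[OF \<phi>(1) Z(1)])
    fix i j assume ij: "1 \<le> i" "i < j" "j \<le> CHAR('a)"
    \<comment> \<open>The pair (2, l) lies on the antidiagonal k = l + 2.\<close>
    have odd: "\<phi> (e 2) (e l) = 0" if "odd l" "3 \<le> l" "l \<le> CHAR('a)" for l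
      using dual[of "Antidiagonal (l + 2)"] that by (simp add: basis_indices_def x)
    show "\<phi> (e i) (e j) = d1 \<psi> (e i) (e j)"
    proof (cases "i = 1")
      case True
      show ?thesis
      proof (cases "j = CHAR('a)")
        case j: True
        have "\<phi> (e 1) (e CHAR('a)) = 0"
          using dual[of Top] by (simp add: basis_indices_def x)
        thus ?thesis
          unfolding True j d1_def using bracket_e_eq_0[of 1 "CHAR('a)", where 'a='a] by (simp add: \<psi>_zero)
      next
        case False
        thus ?thesis
          unfolding True d1_def using bracket_e1_e[of j, where 'a='a] \<psi>_e[of "j + 1"] ij True by simp
      qed
    next
      case False
      hence "2 \<le> i" "2 \<le> j"
        using ij by auto
      hence "\<phi> (e i) (e j) = 0" "bracket (e i) (e j) = (0 :: 'a m0)"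
        using cocycle_vanishes[OF \<phi>(1,3) odd] bracket_e_e[of i j, where 'a='a] by auto
      thus ?thesis
        by (simp add: d1_def \<psi>_zero)
    qed
  qed
  \<comment> \<open>Both maps have the *-property for the same form and vanish on the basis.\<close>
  moreover have "\<omega> = ind1 (\<lambda>_. 0) \<psi>"
  proof (rule star_property_unique[OF assms(1) \<phi>(2)])
    show "star_property \<phi> (ind1 (\<lambda>_. 0) \<psi>)"
      using Z(2) \<open>\<phi> = d1 \<psi>\<close> by simp
    fix k assume "k \<in> {1..CHAR('a)}"
    thus "\<omega> (e k) = ind1 (\<lambda>_. 0) \<psi> (e k)"
      using dual[of "Frobenius k"] by (auto simp: basis_indices_def x ind1_def pmap_zero \<psi>_zero)
  qed
  ultimately show ?thesis
    using B unfolding x d1_res_def by simp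
qed

text \<open>Duality makes every functional vanish on the difference.\<close>

lemma Z2_res_expansion_mod_B2_res:
  assumes "prime CHAR('a::field)" "x \<in> Z2_res (\<lambda>_. 0)"
  shows "x - (\<Sum>i \<in> basis_indices CHAR('a). scale2 (dual_functional i x) (basis_cocycle i :: 'a cochain2)) \<in> B2_res (\<lambda>_. 0)"
    (is "x - ?s \<in> _")
proof (rule Z2_res_with_zero_duals_in_B2_res)
  show "CHAR('a) > 0"
    using prime_gt_0_nat[OF assms(1)] .
  show "x - ?s \<in> Z2_res (\<lambda>_. 0)"
    using assms basis_cocycle_in_Z2_res
    by (intro cochain2.subspace_diff cochain2.subspace_sum cochain2.subspace_scale subspace_Z2_res) auto
  fix j assume j: "j \<in> basis_indices CHAR('a)"
  have "dual_functional j ?s = (\<Sum>i \<in> basis_indices CHAR('a). if j = i then dual_functional i x else 0)"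
    unfolding dual_functional_sum dual_functional_linear
    by (intro sum.cong refl) (simp add: dual_functional_basis_cocycle[OF assms(1) j])
  thus "dual_functional j (x - ?s) = 0"
    using j by (simp add: dual_functional_linear finite_basis_indices)
qed

section \<open>The cohomology space\<close>

text \<open>The kernel of \<open>f\<close> is a subspace that contains the other vectors, hence
  their span, but not b.\<close>

lemma (in vector_space) independent_if_dual_functionals:
  assumes "\<And>b. b \<in> S \<Longrightarrow> \<exists>f :: 'b \<Rightarrow> 'a. (\<forall>x y. f (x + y) = f x + f y) \<and> (\<forall>c x. f (scale c x) = c * f x) \<and>
      f b \<noteq> 0 \<and> (\<forall>b' \<in> S - {b}. f b' = 0)"
  shows "independent S"
proof
  assume "dependent S"
  then obtain b where b: "b \<in> S" "b \<in> span (S - {b})"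
    unfolding dependent_def by blast
  obtain f where f: "\<And>x y. f (x + y) = f x + f y" "\<And>c x. f (scale c x) = c * f x"
    "f b \<noteq> 0" "\<And>b'. b' \<in> S - {b} \<Longrightarrow> f b' = 0"
    using assms[OF b(1)] by blast
  have "f 0 = 0"
    using f(2)[of 0 0] by simp
  hence "subspace {x. f x = 0}"
    by (simp add: subspace_def f(1,2))
  hence "span (S - {b}) \<subseteq> {x. f x = 0}"
    using f(4) by (intro span_minimal) auto
  thus False
    using b(2) f(3) by auto
qed

section \<open>Classes and their representatives\<close>

lemma cohom_class_add:
  assumes "x \<in> Z2_res (\<lambda>_. 0)" "y \<in> Z2_res (\<lambda>_. 0)"
  shows "cohom_class (x + y) = cohom_class x + cohom_class y"
  using assms by (simp add: plus_H2_res.abs_eq cohomologous_refl)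

lemma cohom_class_scale:
  assumes "x \<in> Z2_res (\<lambda>_. 0)"
  shows "cohom_class (scale2 c x) = scale_H2 c (cohom_class x)"
  using assms by (simp add: scale_H2.abs_eq cohomologous_refl)

lemma cohom_class_sum:
  assumes "\<And>a. a \<in> A \<Longrightarrow> f a \<in> Z2_res (\<lambda>_. 0)"
  shows "cohom_class (sum f A) = (\<Sum>a\<in>A. cohom_class (f a))"
  using assms
proof (induction A rule: infinite_finite_induct)
  case (insert a A)
  thus ?case
    using cochain2.subspace_sum[OF subspace_Z2_res, of A f "\<lambda>_. 0"] by (simp add: cohom_class_add)
qed (simp_all add: zero_H2_res_def)

lemma Rep_H2_res_in_Z2_res: "Rep_H2_res h \<in> Z2_res (\<lambda>_. 0)"
  using Quotient_rep_reflp[OF Quotient_H2_res, of h] by (simp add: cohomologous_def)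

lemma cohom_class_Rep_H2_res: "cohom_class (Rep_H2_res h) = h"
  by (rule Quotient_abs_rep[OF Quotient_H2_res])

lemma Rep_H2_res_cohom_class:
  assumes "x \<in> Z2_res (\<lambda>_. 0)"
  shows "Rep_H2_res (cohom_class x) - x \<in> B2_res (\<lambda>_. 0)"
  using cohom_class_eq_iff[OF Rep_H2_res_in_Z2_res assms, of "cohom_class x"] by (simp add: cohom_class_Rep_H2_res)

text \<open>Representatives are chosen arbitrarily, so linearity is available modulo coboundaries;
  that suffices for functionals that kill these.\<close>

lemma Rep_H2_res_add: "Rep_H2_res (g + h) - (Rep_H2_res g + Rep_H2_res h) \<in> B2_res (\<lambda>_. 0)"
  using Rep_H2_res_cohom_class[OF cochain2.subspace_add[OF subspace_Z2_res Rep_H2_res_in_Z2_res Rep_H2_res_in_Z2_res]]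
  by (simp add: cohom_class_add Rep_H2_res_in_Z2_res cohom_class_Rep_H2_res)

lemma Rep_H2_res_scale: "Rep_H2_res (scale_H2 c h) - scale2 c (Rep_H2_res h) \<in> B2_res (\<lambda>_. 0)"
  using Rep_H2_res_cohom_class[OF cochain2.subspace_scale[OF subspace_Z2_res Rep_H2_res_in_Z2_res]]
  by (simp add: cohom_class_scale Rep_H2_res_in_Z2_res cohom_class_Rep_H2_res)

text \<open>All primes are treated at once. The last two claims concern cocycles rather than classes
  and serve p = 2, where no nonzero coboundary exists.\<close>

theorem H2_res_basis:
  assumes "prime CHAR('a::field)"
  defines "I \<equiv> basis_indices CHAR('a)" and "b \<equiv> basis_cocycle :: basis_index \<Rightarrow> 'a cochain2"
  shows "inj_on (\<lambda>i. cohom_class (b i)) I"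
    and "H2.independent ((\<lambda>i. cohom_class (b i)) ` I)"
    and "H2.span ((\<lambda>i. cohom_class (b i)) ` I) = UNIV"
    and "inj_on b I"
    and "cochain2.independent (b ` I)"
proof -
  have bZ: "b i \<in> Z2_res (\<lambda>_. 0)" if "i \<in> I" for i
    using basis_cocycle_in_Z2_res[OF assms(1)] that by (simp add: I_def b_def)
  \<comment> \<open>The dual functionals carried over to classes; their values are independent of
    the representative.\<close>
  define f where "f = (\<lambda>i h. dual_functional i (Rep_H2_res h :: 'a cochain2))"
  have f_class: "f i (cohom_class x) = dual_functional i x" if "i \<in> I" "x \<in> Z2_res (\<lambda>_. 0)" for i x
    using dual_functional_B2_res[OF Rep_H2_res_cohom_class[OF that(2)], of i] that(1)
    by (simp add: f_def I_def dual_functional_linear)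
  have f_add: "f i (g + h) = f i g + f i h" if "i \<in> I" for i g h
    using dual_functional_B2_res[OF Rep_H2_res_add[of g h], of i] that
    by (simp add: f_def I_def dual_functional_linear)
  have f_scale: "f i (scale_H2 c h) = c * f i h" if "i \<in> I" for i c h
    using dual_functional_B2_res[OF Rep_H2_res_scale[of c h], of i] that
    by (simp add: f_def I_def dual_functional_linear)
  have dual: "dual_functional i (b j) = (if i = j then 1 else 0)" if "i \<in> I" "j \<in> I" for i j
    using dual_functional_basis_cocycle[OF assms(1)] that by (simp add: I_def b_def)
  have f_b: "f i (cohom_class (b j)) = (if i = j then 1 else 0)" if "i \<in> I" "j \<in> I" for i j
    using f_class[OF that(1) bZ[OF that(2)]] dual[OF that] by simp
  show "inj_on (\<lambda>i. cohom_class (b i)) I"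
  proof (rule inj_onI)
    fix i j assume "i \<in> I" "j \<in> I" "cohom_class (b i) = cohom_class (b j)"
    thus "i = j"
      using f_b[of i i] f_b[of i j] by (auto split: if_splits)
  qed
  show "inj_on b I"
  proof (rule inj_onI)
    fix i j assume "i \<in> I" "j \<in> I" "b i = b j"
    thus "i = j"
      using dual[of i i] dual[of i j] by (auto split: if_splits)
  qed
  show "H2.independent ((\<lambda>i. cohom_class (b i)) ` I)"
  proof (rule H2.independent_if_dual_functionals, elim imageE)
    fix h i assume "i \<in> I" "h = cohom_class (b i)"
    thus "\<exists>f :: 'a H2_res \<Rightarrow> 'a. (\<forall>x y. f (x + y) = f x + f y) \<and> (\<forall>c x. f (scale_H2 c x) = c * f x) \<and>
        f h \<noteq> 0 \<and> (\<forall>h' \<in> (\<lambda>i. cohom_class (b i)) ` I - {h}. f h' = 0)"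
      by (intro exI[of _ "f i"]) (auto simp: f_add f_scale f_b split: if_splits)
  qed
  show "cochain2.independent (b ` I)"
  proof (rule cochain2.independent_if_dual_functionals, elim imageE)
    fix x i assume "i \<in> I" "x = b i"
    thus "\<exists>f :: 'a cochain2 \<Rightarrow> 'a. (\<forall>x y. f (x + y) = f x + f y) \<and> (\<forall>c x. f (scale2 c x) = c * f x) \<and>
        f x \<noteq> 0 \<and> (\<forall>x' \<in> b ` I - {x}. f x' = 0)"
      by (intro exI[of _ "dual_functional i"]) (auto simp: dual_functional_linear dual split: if_splits)
  qed
  show "H2.span ((\<lambda>i. cohom_class (b i)) ` I) = UNIV"
  proof (intro equalityI subsetI UNIV_I)
    fix h :: "'a H2_res"
    define x where "x = Rep_H2_res h"
    have x: "x \<in> Z2_res (\<lambda>_. 0)"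
      by (simp add: x_def Rep_H2_res_in_Z2_res)
    have Z: "scale2 (dual_functional i x) (b i) \<in> Z2_res (\<lambda>_. 0)" if "i \<in> I" for i
      using bZ[OF that] by (intro cochain2.subspace_scale subspace_Z2_res)
    have "(\<Sum>i\<in>I. scale2 (dual_functional i x) (b i)) \<in> Z2_res (\<lambda>_. 0)"
      by (intro cochain2.subspace_sum subspace_Z2_res Z)
    hence "cohom_class x = cohom_class (\<Sum>i\<in>I. scale2 (dual_functional i x) (b i))"
      using Z2_res_expansion_mod_B2_res[OF assms(1) x, folded I_def b_def]
        cohom_class_eq_iff[OF x] by blast
    also have "\<dots> = (\<Sum>i\<in>I. scale_H2 (dual_functional i x) (cohom_class (b i)))"
      by (subst cohom_class_sum) (simp_all add: Z bZ cohom_class_scale)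
    finally have "h = (\<Sum>i\<in>I. scale_H2 (dual_functional i x) (cohom_class (b i)))"
      by (simp add: x_def cohom_class_Rep_H2_res)
    also have "\<dots> \<in> H2.span ((\<lambda>i. cohom_class (b i)) ` I)"
      by (intro H2.span_sum H2.span_scale H2.span_base imageI)
    finally show "h \<in> H2.span ((\<lambda>i. cohom_class (b i)) ` I)" .
  qed
qed

corollary dim_H2_res:
  assumes "prime CHAR('a::field)"
  shows "H2.dim (UNIV :: 'a H2_res set) = CHAR('a) + 1 + (CHAR('a) - 1) div 2"
  using H2.dim_eq_card[OF H2_res_basis(3)[OF assms, THEN trans[OF _ H2.span_UNIV[symmetric]]] H2_res_basis(2)[OF assms]]
  by (simp add: card_image H2_res_basis(1)[OF assms] card_basis_indices)

lemma basis_cocycle_image: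
  assumes "CHAR('a::field) = p"
  shows "(basis_cocycle ` basis_indices p :: 'a cochain2 set) = (\<lambda>k. (0, ebar k)) ` {1..p}
    \<union> {(e2 1 p, tilde (e2 1 p))} \<union> (\<lambda>k. (\<phi>_odd k, tilde (\<phi>_odd k))) ` {k. odd k \<and> 5 \<le> k \<and> k \<le> p + 2}"
  unfolding basis_indices_def image_Un image_image by (simp add: assms)

section \<open>The abelian case p = 2\<close>

lemma bracket_CHAR_2:
  assumes "CHAR('a::field) = 2"
  shows "bracket g h = (0 :: 'a m0)"
  by (rule m0_eqI) (auto simp: coord_bracket assms)

text \<open>All brackets are 0, so the cocycle identity is void.\<close>

lemma Z2_res_CHAR_2:
  assumes "CHAR('a::field) = 2"
  shows "Z2_res (\<lambda>_. 0) = (C2_res :: 'a cochain2 set)"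
proof -
  have "d2 \<phi> = 0" if "\<phi> \<in> C2" for \<phi> :: "'a m0 \<Rightarrow> 'a m0 \<Rightarrow> 'a"
    by (simp add: fun_eq_iff d2_def bracket_CHAR_2[OF assms] C2_simps(6)[OF that])
  thus ?thesis
    by (auto simp: Z2_res_zero_iff C2_res_def)
qed

lemma B2_res_CHAR_2:
  assumes "CHAR('a::field) = 2"
  shows "B2_res (\<lambda>_. 0) = {0 :: 'a cochain2}"
proof -
  have "\<psi> 0 = 0" if "\<psi> \<in> C1" for \<psi> :: "'a m0 \<Rightarrow> 'a"
    using that by (rule C1_zero)
  hence "d1_res (\<lambda>_. 0) \<psi> = 0" if "\<psi> \<in> C1" for \<psi> :: "'a m0 \<Rightarrow> 'a"
    using that by (simp add: d1_res_def zero_prod_def fun_eq_iff d1_def ind1_def bracket_CHAR_2[OF assms] pmap_zero)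
  moreover have "0 \<in> B2_res (\<lambda>_. 0)"
    by (rule cochain2.subspace_0[OF subspace_B2_res])
  ultimately show ?thesis
    by (auto simp: B2_res_def)
qed

theorem theorem4p2:
  fixes p :: nat
  assumes "prime p" and "CHAR('a::field) = p"
  shows
    "(p = 2 \<longrightarrow>
        (\<exists>f :: 'a H2_res \<Rightarrow> 'a cochain2.
           Vector_Spaces.linear scale_H2 scale2 f \<and> bij_betw f UNIV C2_res) \<and>
        (C2_res :: 'a cochain2 set) =
          cochain2.span {(0, ebar 1), (0, ebar 2), (e2 1 2, tilde (e2 1 2))} \<and>
        cochain2.dim (C2_res :: 'a cochain2 set) = 3 \<and>
        H2.dim (UNIV :: 'a H2_res set) = 3) \<and>
     (p \<ge> 3 \<longrightarrow>
        real (H2.dim (UNIV :: 'a H2_res set)) = (3 * real p + 1) / 2 \<and>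
        (let R = (\<lambda>k. (0, ebar k)) ` {1..p}
                 \<union> {(e2 1 p, tilde (e2 1 p))}
                 \<union> (\<lambda>k. (\<phi>_odd k, tilde (\<phi>_odd k))) ` {k. odd k \<and> 5 \<le> k \<and> k \<le> p + 2}
         in R \<subseteq> Z2_res (\<lambda>_. 0) \<and>
            inj_on cohom_class R \<and>
            H2.independent (cohom_class ` R) \<and>
            H2.span (cohom_class ` R) = (UNIV :: 'a H2_res set)))"
proof (intro conjI impI)
  have prime: "prime CHAR('a)"
    using assms by simp
  note basis = H2_res_basis[OF prime]
  {
    assume p2: "p = 2"
    hence char2: "CHAR('a) = 2"
      using assms by simp
    note Z = Z2_res_CHAR_2[OF char2] and B = B2_res_CHAR_2[OF char2]
    \<comment> \<open>The coboundary space is 0, so each class has a single representative and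
      taking it is the isomorphism.\<close>
    have "Vector_Spaces.linear scale_H2 scale2 (Rep_H2_res :: 'a H2_res \<Rightarrow> 'a cochain2)"
      unfolding Vector_Spaces.linear_iff
      using H2.vector_space_axioms cochain2.vector_space_axioms
        Rep_H2_res_add[where 'a='a, unfolded B] Rep_H2_res_scale[where 'a='a, unfolded B] by simp
    moreover have "bij_betw Rep_H2_res UNIV (C2_res :: 'a cochain2 set)"
    proof (rule bij_betw_imageI)
      show "inj (Rep_H2_res :: 'a H2_res \<Rightarrow> _)"
        by (metis injI cohom_class_Rep_H2_res)
      have "Rep_H2_res (cohom_class x) = x" if "x \<in> C2_res" for x :: "'a cochain2"
        using Rep_H2_res_cohom_class[of x, unfolded B Z] that by simp
      thus "range Rep_H2_res = (C2_res :: 'a cochain2 set)"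
        using Rep_H2_res_in_Z2_res[where 'a='a, unfolded Z] by (metis image_subsetI rangeI subsetI subset_antisym)
    qed
    ultimately show "\<exists>f :: 'a H2_res \<Rightarrow> 'a cochain2.
        Vector_Spaces.linear scale_H2 scale2 f \<and> bij_betw f UNIV C2_res"
      by blast
    let ?R = "{(0, ebar 1), (0, ebar 2), (e2 1 2, tilde (e2 1 2))} :: 'a cochain2 set"
    have idx: "{k. odd k \<and> 5 \<le> k \<and> k \<le> (2::nat) + 2} = {}" "{1..2::nat} = {1, 2}"
      by auto
    have R: "basis_cocycle ` basis_indices CHAR('a) = ?R"
      unfolding char2 basis_cocycle_image[OF char2] idx by auto
    show span: "C2_res = cochain2.span ?R"
    proof (intro equalityI subsetI)
      fix x :: "'a cochain2" assume x: "x \<in> C2_res"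
      \<comment> \<open>Modulo the zero space of coboundaries the expansion is an equality.\<close>
      hence "x = (\<Sum>i \<in> basis_indices CHAR('a). scale2 (dual_functional i x) (basis_cocycle i))"
        using Z2_res_expansion_mod_B2_res[OF prime, of x, unfolded Z B] by simp
      also have "\<dots> \<in> cochain2.span ?R"
        unfolding R[symmetric] by (intro cochain2.span_sum cochain2.span_scale cochain2.span_base imageI)
      finally show "x \<in> cochain2.span ?R" .
    next
      have "?R \<subseteq> C2_res"
        unfolding R[symmetric] Z[symmetric] using basis_cocycle_in_Z2_res[OF prime] by blast
      thus "x \<in> C2_res" if "x \<in> cochain2.span ?R" for x
        using that cochain2.span_minimal[OF _ subspace_C2_res] by blast
    qed
    have "cochain2.dim (C2_res :: 'a cochain2 set) = card ?R"
      unfolding span cochain2.dim_span by (rule cochain2.dim_eq_card_independent) (use basis(5) R in simp)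
    also have "\<dots> = card (basis_indices CHAR('a))"
      unfolding R[symmetric] by (rule card_image[OF basis(4)])
    also have "\<dots> = 3"
      unfolding card_basis_indices char2 by simp
    finally show "cochain2.dim (C2_res :: 'a cochain2 set) = 3" .
    show "H2.dim (UNIV :: 'a H2_res set) = 3"
      unfolding dim_H2_res[OF prime] char2 by simp
  }
  assume p3: "3 \<le> p"
  hence "odd p"
    using assms(1) prime_odd_nat by force
  \<comment> \<open>Then (p - 1) div 2 is c, and both sides equal 3c + 2.\<close>
  then obtain c where "p = 2 * c + 1"
    by (elim oddE)
  thus "real (H2.dim (UNIV :: 'a H2_res set)) = (3 * real p + 1) / 2"
    unfolding dim_H2_res[OF prime] assms(2) by simp
  show "let R = (\<lambda>k. (0, ebar k)) ` {1..p}
                 \<union> {(e2 1 p, tilde (e2 1 p))}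
                 \<union> (\<lambda>k. (\<phi>_odd k, tilde (\<phi>_odd k))) ` {k. odd k \<and> 5 \<le> k \<and> k \<le> p + 2}
         in R \<subseteq> Z2_res (\<lambda>_. 0) \<and>
            inj_on cohom_class R \<and>
            H2.independent (cohom_class ` R) \<and>
            H2.span (cohom_class ` R) = (UNIV :: 'a H2_res set)"
    unfolding basis_cocycle_image[OF assms(2), symmetric] Let_def
  proof (intro conjI)
    show "basis_cocycle ` basis_indices p \<subseteq> (Z2_res (\<lambda>_. 0) :: 'a cochain2 set)"
      using basis_cocycle_in_Z2_res[OF prime] assms(2) by blast
    show "inj_on cohom_class (basis_cocycle ` basis_indices p :: 'a cochain2 set)"
      using basis(1) unfolding assms(2) by (auto simp: inj_on_def)
    show "H2.independent (cohom_class ` (basis_cocycle ` basis_indices p :: 'a cochain2 set))"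
      "H2.span (cohom_class ` (basis_cocycle ` basis_indices p :: 'a cochain2 set)) = UNIV"
      using basis(2,3) unfolding assms(2) image_image by auto
  qed
qed

end
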